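(* Let $L>0$ be fixed, let $\kappa>0$, $\gamma\ge 0$ and $\omega\in\left(\frac{4\pi^2}{L^2},+\infty\right)$, and let $\varphi=\varphi_\omega\in H^1_{\rm per}$ be the $L$-periodic solution with cnoidal profile (defined in the context) of $$-\varphi''+\omega\varphi-(\kappa+\gamma B^3)\varphi^5=0 .$$ If $B=1$ and $\gamma=2\kappa$, then the standing wave $\Phi=(\varphi,\varphi,0,0)$ of the quintic Schrödinger system is spectrally unstable in $\mathbb{H}^1_{\rm per}$.
   Context: Function spaces: for $s\ge 0$, $H^s_{\rm per}$ is the Sobolev space of complex-valued $L$-periodic functions, $L^2_{\rm per}=H^0_{\rm per}$, and $\mathbb{H}^s_{\rm per}=(H^s_{\rm per})^4$. System: $iu_t+u_{xx}+\kappa|u|^4u+\gamma v^3\overline{u}^2=0$, $\; iv_t+v_{xx}+\kappa|v|^4v+\gamma u^3\overline{v}^2=0$, for complex-valued $u,v$ that are $L$-periodic in $x\in\mathbb{R}$. Standing waves have the form $(u,v)=e^{i\omega t}(\varphi(x),B\varphi(x))$ with $\varphi$ real and $B\in\mathbb{R}$; identifying $(u,v)$ with $(\mathrm{Re}\,u,\mathrm{Re}\,v,\mathrm{Im}\,u,\mathrm{Im}\,v)$, the wave is represented by $\Phi=(\varphi,B\varphi,0,0)$. Cnoidal profile: for $k\in(0,1)$ let $\mathrm{sn}(\cdot,k),\mathrm{cn}(\cdot,k)$ be the Jacobi elliptic functions and $\mathrm{K}(k)$ the complete elliptic integral of the first kind (modulus $k$). Then $$\varphi(x)=\frac{1}{\sqrt[4]{\kappa+\gamma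 B^3}}\,\frac{a\,\mathrm{cn}\left(\frac{4\mathrm{K}(k)}{L}x,k\right)}{\sqrt{1-q\,\mathrm{sn}^2\left(\frac{4\mathrm{K}(k)}{L}x,k\right)}},$$ $$a=\frac{2}{L}\left[\left(2-k^2+2\sqrt{k^4-k^2+1}\right)L^2\mathrm{K}(k)^2\right]^{1/4},\qquad q=-1+k^2-\sqrt{k^4-k^2+1},$$ where $k\in(0,1)$ is determined by $\omega=\frac{16\mathrm{K}(k)^2\sqrt{k^4-k^2+1}}{L^2}$, which maps $(0,1)$ bijectively onto $(4\pi^2/L^2,+\infty)$. Linearized operator: with $J=\begin{bmatrix}0&\mathrm{Id}_{2\times2}\\-\mathrm{Id}_{2\times2}&0\end{bmatrix}$, let $\mathcal{L}=(-\partial_x^2+\omega)\mathrm{Id}_{4\times4}-\varphi^4S$ on $(L^2_{\rm per})^4$ with domain $\mathbb{H}^2_{\rm per}$, where $$S=\begin{bmatrix}5\kappa+2\gamma B^3&3\gamma B^2&0&0\\3\gamma B^2&5\kappa B^4+2\gamma B&0&0\\0&0&\kappa-2\gamma B^3&3\gamma B^2\\0&0&3\gamma B^2&\kappa B^4-2\gamma B\end{bmatrix}.$$ The linearized evolution is $W_t=J\mathcal{L}W$. Spectral stability: $\Phi$ is spectrally stable (with respect to perturbations of the same period $L$) if $\sigma(J\mathcal{L})\subset i\mathbb{R}$; it is spectrally unstable if $J\mathcal{L}$ has at least one eigenvalue $\lambda\in\mathbb{C}$ with positive real part. *)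

theory Defs
  imports "HOL-Analysis.Analysis"
begin

section \<open>Jacobi elliptic functions (argument \<open>u\<close>, modulus \<open>k\<close>)\<close>

text \<open>The interval integral is oriented, so \<open>ellipticF k\<close> is odd; for \<open>0 < k < 1\<close> it is an
  increasing bijection of the real line, and the amplitude is its inverse.\<close>

definition ellipticF :: "real \<Rightarrow> real \<Rightarrow> real" where
  "ellipticF k x = (LBINT t=0..x. 1 / sqrt (1 - k\<^sup>2 * (sin t)\<^sup>2))"

definition ellipticK :: "real \<Rightarrow> real" where
  "ellipticK k = ellipticF k (pi / 2)"

definition jacobi_am :: "real \<Rightarrow> real \<Rightarrow> real" where
  "jacobi_am u k = (THE x. ellipticF k x = u)"

definition jacobi_sn :: "real \<Rightarrow> real \<Rightarrow> real" where
  "jacobi_sn u k = sin (jacobi_am u k)"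

definition jacobi_cn :: "real \<Rightarrow> real \<Rightarrow> real" where
  "jacobi_cn u k = cos (jacobi_am u k)"


section \<open>The cnoidal profile\<close>

definition cnoidal_frequency :: "real \<Rightarrow> real \<Rightarrow> real" where
  "cnoidal_frequency L k = 16 * (ellipticK k)\<^sup>2 * sqrt (k^4 - k\<^sup>2 + 1) / L\<^sup>2"

definition cnoidal_amplitude :: "real \<Rightarrow> real \<Rightarrow> real" where
  "cnoidal_amplitude L k =
     2 / L * root 4 ((2 - k\<^sup>2 + 2 * sqrt (k^4 - k\<^sup>2 + 1)) * L\<^sup>2 * (ellipticK k)\<^sup>2)"

definition cnoidal_q :: "real \<Rightarrow> real" where
  "cnoidal_q k = - 1 + k\<^sup>2 - sqrt (k^4 - k\<^sup>2 + 1)"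

definition cnoidal_profile :: "real \<Rightarrow> real \<Rightarrow> real \<Rightarrow> real \<Rightarrow> real \<Rightarrow> real \<Rightarrow> real" where
  "cnoidal_profile L \<kappa> \<gamma> B k x =
     1 / root 4 (\<kappa> + \<gamma> * B^3) *
     (cnoidal_amplitude L k * jacobi_cn (4 * ellipticK k / L * x) k /
      sqrt (1 - cnoidal_q k * (jacobi_sn (4 * ellipticK k / L * x) k)\<^sup>2))"


section \<open>Periodic Sobolev spaces\<close>

text \<open>Elements of the spaces are represented by Borel functions on the real line; identities
  between elements are therefore always meant almost everywhere.\<close>

definition L2_per :: "real \<Rightarrow> (real \<Rightarrow> complex) set" where
  "L2_per L = {f. f \<in> borel_measurable borel \<and> (\<forall>x. f (x + L) = f x) \<and>
                  set_integrable lborel {0..L} (\<lambda>x. (cmod (f x))\<^sup>2)}"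

definition fourier_coeff :: "real \<Rightarrow> (real \<Rightarrow> complex) \<Rightarrow> int \<Rightarrow> complex" where
  "fourier_coeff L f n =
     complex_of_real (1 / L) * (LINT x:{0..L}|lborel. f x * cis (- (2 * pi * real_of_int n * x / L)))"

definition H_per :: "real \<Rightarrow> real \<Rightarrow> (real \<Rightarrow> complex) set" where
  "H_per L s = {f \<in> L2_per L.
     (\<lambda>n::int. (1 + (real_of_int n)\<^sup>2) powr s * (cmod (fourier_coeff L f n))\<^sup>2) summable_on UNIV}"

text \<open>\<open>g\<close> is the \<open>m\<close>-th derivative of \<open>f\<close> in the sense of periodic distributions.\<close>

definition has_per_deriv :: "real \<Rightarrow> nat \<Rightarrow> (real \<Rightarrow> complex) \<Rightarrow> (real \<Rightarrow> complex) \<Rightarrow> bool" where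
  "has_per_deriv L m f g \<longleftrightarrow> f \<in> L2_per L \<and> g \<in> L2_per L \<and>
     (\<forall>n. fourier_coeff L g n =
            (\<i> * complex_of_real (2 * pi * real_of_int n / L)) ^ m * fourier_coeff L f n)"

definition L2_per4 :: "real \<Rightarrow> (real \<Rightarrow> complex^4) set" where
  "L2_per4 L = {W. \<forall>i. (\<lambda>x. W x $ i) \<in> L2_per L}"

definition H_per4 :: "real \<Rightarrow> real \<Rightarrow> (real \<Rightarrow> complex^4) set" where
  "H_per4 L s = {W. \<forall>i. (\<lambda>x. W x $ i) \<in> H_per L s}"


section \<open>The linearized operator\<close>

definition matJ :: "real^4^4" where
  "matJ = vector [vector [ 0,  0, 1, 0],
                  vector [ 0,  0, 0, 1],
                  vector [-1,  0, 0, 0],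
                  vector [ 0, -1, 0, 0]]"

definition matS :: "real \<Rightarrow> real \<Rightarrow> real \<Rightarrow> real^4^4" where
  "matS \<kappa> \<gamma> B = vector
     [vector [5*\<kappa> + 2*\<gamma>*B^3, 3*\<gamma>*B^2, 0, 0],
      vector [3*\<gamma>*B^2, 5*\<kappa>*B^4 + 2*\<gamma>*B, 0, 0],
      vector [0, 0, \<kappa> - 2*\<gamma>*B^3, 3*\<gamma>*B^2],
      vector [0, 0, 3*\<gamma>*B^2, \<kappa>*B^4 - 2*\<gamma>*B]]"

definition cmat :: "real^4^4 \<Rightarrow> complex^4^4" where
  "cmat = map_matrix complex_of_real"

text \<open>Unbounded operators on the fourfold product of \<open>L2_per L\<close> are given by their graphs.\<close>

definition linearized_op ::
  "real \<Rightarrow> real \<Rightarrow> real \<Rightarrow> real \<Rightarrow> real \<Rightarrow> (real \<Rightarrow> real) \<Rightarrow> ((real \<Rightarrow> complex^4) \<times> (real \<Rightarrow> complex^4)) set"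
  where
  "linearized_op L \<kappa> \<gamma> B \<omega> \<phi> = {(W, Z). W \<in> H_per4 L 2 \<and> Z \<in> L2_per4 L \<and>
     (\<exists>D. (\<forall>i. has_per_deriv L 2 (\<lambda>x. W x $ i) (\<lambda>x. D x $ i)) \<and>
          (AE x in lborel. Z x = - D x + complex_of_real \<omega> *s W x
             - complex_of_real ((\<phi> x)^4) *s (cmat (matS \<kappa> \<gamma> B) *v W x)))}"

definition J_linearized_op ::
  "real \<Rightarrow> real \<Rightarrow> real \<Rightarrow> real \<Rightarrow> real \<Rightarrow> (real \<Rightarrow> real) \<Rightarrow> ((real \<Rightarrow> complex^4) \<times> (real \<Rightarrow> complex^4)) set"
  where
  "J_linearized_op L \<kappa> \<gamma> B \<omega> \<phi> =
     {(W, \<lambda>x. cmat matJ *v Z x) | W Z. (W, Z) \<in> linearized_op L \<kappa> \<gamma> B \<omega> \<phi>}"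

definition is_eigenvalue ::
  "((real \<Rightarrow> complex^4) \<times> (real \<Rightarrow> complex^4)) set \<Rightarrow> complex \<Rightarrow> bool" where
  "is_eigenvalue T \<mu> \<longleftrightarrow>
     (\<exists>W. \<not> (AE x in lborel. W x = 0) \<and> (W, \<lambda>x. \<mu> *s W x) \<in> T)"

text \<open>Spectral instability of the standing wave \<open>(\<phi>, B \<phi>, 0, 0)\<close> of frequency \<open>\<omega>\<close> with respect to
  perturbations of period \<open>L\<close>.\<close>

definition spectrally_unstable ::
  "real \<Rightarrow> real \<Rightarrow> real \<Rightarrow> real \<Rightarrow> real \<Rightarrow> (real \<Rightarrow> real) \<Rightarrow> bool" where
  "spectrally_unstable L \<kappa> \<gamma> B \<omega> \<phi> \<longleftrightarrow>
     (\<exists>\<mu>. Re \<mu> > 0 \<and> is_eigenvalue (J_linearized_op L \<kappa> \<gamma> B \<omega> \<phi>) \<mu>)"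

end

theory Submission
  imports Defs
begin

text \<open>
  Put \<open>V = 3 \<kappa> \<phi>\<^sup>4\<close>. For \<open>B = 1\<close> and \<open>\<gamma> = 2 \<kappa>\<close> the matrix \<open>S\<close> leaves the vectors \<open>(u, -u, v, -v)\<close>
  invariant, and on them the eigenvalue equation of \<open>J \<L>\<close> reduces to
    \<open>\<mu> v = u'' - \<omega> u + V u\<close> and \<open>\<mu> u = - v'' + \<omega> v + 3 V v\<close>.
  The operator \<open>A = -\<partial>\<^sup>2 + \<omega> - V\<close> kills the sign-changing profile, so it has a negative direction, while
  \<open>C = -\<partial>\<^sup>2 + \<omega> + 3 V\<close> is positive. Minimising \<open>\<langle>A u, u\<rangle> / \<langle>C\<^sup>-\<^sup>1 u, u\<rangle>\<close> would therefore give a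
  positive eigenvalue \<open>\<mu>\<close>. The proof finds it by shooting instead, which replaces the
  compactness of a minimising sequence by continuity of solutions in the parameter.

  With \<open>w = u + \<i> v\<close> and \<open>T = L / 4\<close>, the potential \<open>V\<close> is even about \<open>0\<close> and about \<open>T\<close>, so that a
  solution with \<open>w' = 0\<close> at both \<open>0\<close> and \<open>T\<close> is \<open>2 T\<close>-periodic by uniqueness. A nontrivial one exists iff the
  determinant \<open>D(\<mu>, s)\<close> of the real linear map \<open>w(0) \<mapsto> w'(T)\<close> vanishes at \<open>s = 1\<close>, where \<open>s V\<close>
  replaces \<open>V\<close>. At \<open>\<mu> = 0\<close> the system decouples and \<open>D(0, 1) < 0\<close>: the first factor is
  \<open>\<phi>'(T) / \<phi>(0) < 0\<close> and the second is positive by convexity. If \<open>\<Lambda> > 2 max V\<close>, then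
  \<open>Im (cnj w * w')\<close> is strictly decreasing as long as \<open>w \<noteq> 0\<close>, which forces \<open>D(\<Lambda>, s) \<noteq> 0\<close> for all \<open>s\<close> in
  \<open>[0, 1]\<close>; at \<open>s = 0\<close> the map is complex linear, so its determinant is a squared modulus. Hence
  \<open>D(\<Lambda>, 1) > 0\<close>, and \<open>D(\<mu>, 1) = 0\<close> for some \<open>\<mu>\<close> strictly between \<open>0\<close> and \<open>\<Lambda>\<close> (lemma \<open>unstable_mode_exists\<close>).

  The remaining ingredients are the parameter-dependent linear initial value problem
  (\<open>linear_ode_solution_exists\<close>, \<open>linear_ode_unique\<close>), the verification that the cnoidal profile solves
  its equation (\<open>cnoidal_profile_ode\<close>), and Bessel's inequality, by which a \<open>C\<^sup>2\<close> periodic function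
  lies in the Fourier-side space \<open>H_per L 2\<close> (\<open>C2_periodic_has_per_deriv\<close>).
\<close>

section \<open>Linear differential equations depending on a parameter\<close>

text \<open>Writing the antiderivative of \<open>g\<close> that vanishes at \<open>0\<close> as \<open>t \<integral>\<^sub>0\<^sup>1 g(s t) ds\<close> keeps the domain of
  integration fixed. It then makes sense for either sign of \<open>t\<close>, and its continuity in parameters is
  that of an integral over a compact interval.\<close>

lemma has_vector_derivative_scaled_integral:
  fixes g :: "real \<Rightarrow> 'a::banach"
  assumes g: "continuous_on UNIV g"
  shows "((\<lambda>t. t *\<^sub>R integral {0..1} (\<lambda>s. g (s * t))) has_vector_derivative g t) (at t)"
proof -
  define X where "X = \<bar>t\<bar> + 1"
  define G where "G = (\<lambda>u. integral {-X..u} g)"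
  have G: "(G has_vector_derivative g u) (at u within {-X..X})" if "u \<in> {-X..X}" for u
    unfolding G_def by (rule integral_has_vector_derivative) (use that g continuous_on_subset in auto)
  have eq: "u *\<^sub>R integral {0..1} (\<lambda>s. g (s * u)) = G u - G 0" if u: "u \<in> {-X<..<X}" for u
  proof -
    have sub: "(\<lambda>s. s * u) ` {0..1} \<subseteq> {-X..X}"
    proof clarify
      fix s :: real assume "s \<in> {0..1}"
      then have "\<bar>s * u\<bar> \<le> 1 * \<bar>u\<bar>" unfolding abs_mult by (intro mult_right_mono) auto
      then show "s * u \<in> {-X..X}" using u by auto
    qed
    have "((\<lambda>s. G (s * u)) has_vector_derivative u *\<^sub>R g (s * u)) (at s within {0..1})"
      if "s \<in> {0..1}" for s
    proof -
      have *: "((\<lambda>s. s * u) has_vector_derivative u) (at s within {0..1})"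
        by (auto intro!: derivative_eq_intros)
      show ?thesis
        using vector_diff_chain_within[OF * has_vector_derivative_within_subset[OF G sub]] sub that
        by (simp add: o_def image_subset_iff)
    qed
    then have "((\<lambda>s. u *\<^sub>R g (s * u)) has_integral (G (1 * u) - G (0 * u))) {0..1}"
      by (intro fundamental_theorem_of_calculus) auto
    from integral_unique[OF this] show ?thesis by simp
  qed
  have "t \<in> {-X<..<X}" by (auto simp: X_def)
  moreover have "((\<lambda>u. G u - G 0) has_vector_derivative g t) (at t)"
    using has_vector_derivative_diff[OF _ has_vector_derivative_const, of G "g t" "at t" "G 0"]
      G[of t] \<open>t \<in> {-X<..<X}\<close> by (simp add: at_within_Icc_at)
  ultimately show ?thesis
    by (rule_tac has_vector_derivative_transform_within_open[where S="{-X<..<X}"]) (auto simp: eq)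
qed

text \<open>The increments of the Picard iteration for \<open>y' = A(p, t) y\<close>, \<open>y(0) = y0\<close>; the solution is their sum.\<close>

primrec picard_term :: "('p \<Rightarrow> real \<Rightarrow> 'a::real_normed_vector \<Rightarrow>\<^sub>L 'a) \<Rightarrow> 'a \<Rightarrow> nat \<Rightarrow> 'p \<Rightarrow> real \<Rightarrow> 'a" where
  "picard_term A y0 0 p t = y0"
| "picard_term A y0 (Suc n) p t =
     t *\<^sub>R integral {0..1} (\<lambda>s. blinfun_apply (A p (s * t)) (picard_term A y0 n p (s * t)))"

lemma continuous_on_picard_term:
  fixes A :: "'p::topological_space \<Rightarrow> real \<Rightarrow> 'a::banach \<Rightarrow>\<^sub>L 'a"
  assumes A: "continuous_on UNIV (\<lambda>(p, t). A p t)"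
  shows "continuous_on UNIV (\<lambda>(p, t). picard_term A y0 n p t)"
proof (induction n)
  case (Suc n)
  let ?sc = "\<lambda>((p, t), s). (p :: 'p, s * t :: real)"
  have sc: "continuous_on UNIV ?sc"
    by (auto simp: case_prod_unfold intro!: continuous_intros)
  have "continuous_on UNIV (\<lambda>z. blinfun_apply ((\<lambda>(p, t). A p t) (?sc z)) ((\<lambda>(p, t). picard_term A y0 n p t) (?sc z)))"
    by (intro continuous_intros continuous_on_compose2[OF A sc] continuous_on_compose2[OF Suc.IH sc]) auto
  then have "continuous_on (UNIV \<times> cbox 0 1)
    (\<lambda>(z, s). blinfun_apply (A (fst z) (s * snd z)) (picard_term A y0 n (fst z) (s * snd z)))"
    by (rule continuous_on_subset[OF continuous_on_eq]) auto
  from integral_continuous_on_param[OF this]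
  show ?case by (auto simp: case_prod_unfold intro!: continuous_intros)
qed simp

lemma norm_picard_term_le:
  fixes A :: "'p::topological_space \<Rightarrow> real \<Rightarrow> 'a::banach \<Rightarrow>\<^sub>L 'a"
  assumes A: "continuous_on UNIV (\<lambda>(p, t). A p t)"
    and M: "\<And>t. \<bar>t\<bar> \<le> X \<Longrightarrow> norm (A p t) \<le> M" and t: "\<bar>t\<bar> \<le> X"
  shows "norm (picard_term A y0 n p t) \<le> norm y0 * (M * \<bar>t\<bar>) ^ n / fact n"
  using t
proof (induction n arbitrary: t)
  case (Suc n)
  have M0: "M \<ge> 0" using M[OF Suc.prems] norm_ge_zero order_trans by blast
  let ?f = "\<lambda>s. blinfun_apply (A p (s * t)) (picard_term A y0 n p (s * t))"
  let ?g = "\<lambda>s. (M * norm y0 * (M * \<bar>t\<bar>) ^ n / fact n) * s ^ n"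
  have cf: "continuous_on UNIV ?f"
  proof -
    have sc: "continuous_on UNIV (\<lambda>s::real. (p, s * t))" by (intro continuous_intros)
    show ?thesis
      using continuous_on_compose2[OF A sc] continuous_on_compose2[OF continuous_on_picard_term[OF A] sc]
      by (auto intro!: continuous_intros)
  qed
  have gi: "(?g has_integral ((M * norm y0 * (M * \<bar>t\<bar>) ^ n / fact n) * (1 / Suc n))) {0..1}"
  proof (intro has_integral_mult_right)
    have "((\<lambda>s. s ^ n) has_integral (1 ^ Suc n / Suc n - 0 ^ Suc n / Suc n)) {0..1::real}"
      by (rule fundamental_theorem_of_calculus)
        (auto intro!: derivative_eq_intros simp del: of_nat_Suc power_Suc
            simp: has_real_derivative_iff_has_vector_derivative[symmetric])
    then show "((\<lambda>s. s ^ n) has_integral (1 / Suc n)) {0..1::real}" by simp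
  qed
  have "norm (integral {0..1} ?f) \<le> integral {0..1} ?g"
  proof (rule integral_norm_bound_integral)
    show "?f integrable_on {0..1}"
      by (rule integrable_continuous_real) (use cf continuous_on_subset in blast)
    show "?g integrable_on {0..1}" using gi by blast
    fix s :: real assume s: "s \<in> {0..1}"
    have st: "\<bar>s * t\<bar> \<le> X" using s Suc.prems mult_left_le_one_le[of "\<bar>t\<bar>" s] by (simp add: abs_mult)
    have "norm (?f s) \<le> norm (A p (s * t)) * norm (picard_term A y0 n p (s * t))"
      by (rule norm_blinfun)
    also have "\<dots> \<le> M * (norm y0 * (M * \<bar>s * t\<bar>) ^ n / fact n)"
      by (intro mult_mono M st Suc.IH M0) auto
    also have "\<dots> = ?g s" using s by (simp add: abs_mult power_mult_distrib)
    finally show "norm (?f s) \<le> ?g s" .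
  qed
  also have "\<dots> = (M * norm y0 * (M * \<bar>t\<bar>) ^ n / fact n) * (1 / Suc n)"
    using gi by (rule integral_unique)
  finally have "\<bar>t\<bar> * norm (integral {0..1} ?f) \<le> \<bar>t\<bar> * ((M * norm y0 * (M * \<bar>t\<bar>) ^ n / fact n) * (1 / Suc n))"
    by (rule mult_left_mono) auto
  then show ?case by (simp add: mult_ac)
qed simp

text \<open>The Picard series converges uniformly for \<open>p\<close> and \<open>t\<close> in compact sets, so the sum is jointly
  continuous; this is what makes the shooting determinant a continuous function of the parameters.\<close>

lemma linear_ode_solution_exists:
  fixes A :: "'p::heine_borel \<Rightarrow> real \<Rightarrow> 'a::banach \<Rightarrow>\<^sub>L 'a" and y0 :: 'a
  assumes A: "continuous_on UNIV (\<lambda>(p, t). A p t)"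
  obtains y where "continuous_on UNIV (\<lambda>(p, t). y p t)" "\<And>p. y p 0 = y0"
    "\<And>p t. (y p has_vector_derivative blinfun_apply (A p t) (y p t)) (at t)"
proof -
  let ?Y = "picard_term A y0"
  define y where "y = (\<lambda>p t. \<Sum>n. ?Y n p t)"
  have bound: "\<exists>M. \<forall>p\<in>cball p0 1. \<forall>t. \<bar>t\<bar> \<le> X \<longrightarrow> norm (A p t) \<le> M" for p0 X
  proof -
    have "compact ((\<lambda>(p, t). A p t) ` (cball p0 1 \<times> {-X..X}))"
      by (intro compact_continuous_image continuous_on_subset[OF A] compact_Times) auto
    then obtain M where "\<forall>z\<in>(\<lambda>(p, t). A p t) ` (cball p0 1 \<times> {-X..X}). norm z \<le> M"
      using compact_imp_bounded bounded_iff by blast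
    then have "\<And>p t. p \<in> cball p0 1 \<Longrightarrow> \<bar>t\<bar> \<le> X \<Longrightarrow> norm (A p t) \<le> M"
      by (force simp: abs_le_iff)
    then show ?thesis by blast
  qed
  have unif: "uniform_limit (cball p0 1 \<times> {-X..X}) (\<lambda>n (p, t). \<Sum>i<n. ?Y i p t) (\<lambda>(p, t). y p t) sequentially"
    for p0 X
  proof -
    obtain M where M: "\<And>p t. p \<in> cball p0 1 \<Longrightarrow> \<bar>t\<bar> \<le> X \<Longrightarrow> norm (A p t) \<le> M"
      using bound[of p0 X] by blast
    have "uniform_limit (cball p0 1 \<times> {-X..X}) (\<lambda>n z. \<Sum>i<n. ?Y i (fst z) (snd z))
       (\<lambda>z. \<Sum>i. ?Y i (fst z) (snd z)) sequentially"
    proof (rule Weierstrass_m_test)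
      fix n and z :: "'p \<times> real" assume z: "z \<in> cball p0 1 \<times> {-X..X}"
      then have "norm (?Y n (fst z) (snd z)) \<le> norm y0 * (M * \<bar>snd z\<bar>) ^ n / fact n"
        by (intro norm_picard_term_le[OF A, of X] M) auto
      also have "\<dots> \<le> norm y0 * (M * X) ^ n / fact n"
      proof -
        have "M \<ge> 0" 
          using order_trans[OF norm_ge_zero M[of "fst z" "snd z"]] z
          by (auto simp: abs_le_iff mem_Times_iff)
        then show ?thesis using z by (intro divide_right_mono mult_left_mono power_mono) auto
      qed
      finally show "norm (?Y n (fst z) (snd z)) \<le> norm y0 * ((M * X) ^ n / fact n)" by simp
    next
      show "summable (\<lambda>n. norm y0 * ((M * X) ^ n / fact n))"
        using summable_exp[of "M * X"] by (intro summable_mult) (simp add: divide_inverse mult.commute)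
    qed
    then show ?thesis by (simp add: y_def case_prod_unfold)
  qed
  have cont: "continuous_on UNIV (\<lambda>(p, t). y p t)"
  proof -
    have "isCont (\<lambda>(p, t). y p t) (p0, t0)" for p0 t0
    proof -
      let ?X = "\<bar>t0\<bar> + 1"
      have "continuous_on (cball p0 1 \<times> {-?X..?X}) (\<lambda>(p, t). y p t)"
      proof (rule uniform_limit_theorem[OF _ unif])
        have "continuous_on UNIV (\<lambda>(p, t). \<Sum>i<n. ?Y i p t)" for n
          using continuous_on_picard_term[OF A] by (auto simp: case_prod_unfold intro!: continuous_intros)
        then show "\<forall>\<^sub>F n in sequentially. continuous_on (cball p0 1 \<times> {-?X..?X}) (\<lambda>(p, t). \<Sum>i<n. ?Y i p t)"
          using continuous_on_subset by (blast intro: always_eventually)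
      qed simp
      moreover have "(p0, t0) \<in> interior (cball p0 1 \<times> {-?X..?X})"
      proof (rule interiorI)
        show "open (ball p0 1 \<times> {-?X<..<?X})" by (intro open_Times) auto
      qed auto
      ultimately show ?thesis by (rule continuous_on_interior)
    qed
    then show ?thesis by (auto simp: continuous_on_eq_continuous_at)
  qed
  have sc: "continuous_on UNIV (\<lambda>s::real. (p :: 'p, s * t))" for p t
    by (intro continuous_intros)
  have contA: "continuous_on UNIV (\<lambda>s. A p (s * t))" for p t
    using continuous_on_compose2[OF A sc[of p t]] by simp
  have conty: "continuous_on UNIV (\<lambda>s. y p (s * t))" for p t
    using continuous_on_compose2[OF cont sc[of p t]] by simp
  have contY: "continuous_on UNIV (\<lambda>s. ?Y n p (s * t))" for n p t
    using continuous_on_compose2[OF continuous_on_picard_term[OF A, of y0 n] sc[of p t]] by simp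
  have fix_eq: "y p t = y0 + t *\<^sub>R integral {0..1} (\<lambda>s. blinfun_apply (A p (s * t)) (y p (s * t)))" for p t
  proof -
    let ?S = "\<lambda>n t. \<Sum>i<n. ?Y i p t"
    have tS: "(\<lambda>n. ?S n u) \<longlonglongrightarrow> y p u" for u
      using tendsto_uniform_limitI[OF unif[of p "\<bar>u\<bar>"], of "(p, u)"] abs_le_iff[of u "\<bar>u\<bar>"] by auto
    have uS: "uniform_limit (cbox 0 1) (\<lambda>n s. ?S n (s * t)) (\<lambda>s. y p (s * t)) sequentially"
    proof -
      have sub: "\<bar>s * t\<bar> \<le> \<bar>t\<bar>" if "s \<in> {0..1}" for s
        using that mult_left_le_one_le[of "\<bar>t\<bar>" s] by (simp add: abs_mult)
      have "(\<lambda>s. (p, s * t)) \<in> cbox 0 1 \<rightarrow> cball p 1 \<times> {-\<bar>t\<bar>..\<bar>t\<bar>}"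
        using sub by (force simp: abs_le_iff)
      from uniform_limit_compose'[OF unif this]
      show ?thesis by (auto simp: case_prod_unfold)
    qed
    have ul: "uniform_limit (cbox 0 1) (\<lambda>n s. blinfun_apply (A p (s * t)) (?S n (s * t)))
       (\<lambda>s. blinfun_apply (A p (s * t)) (y p (s * t))) sequentially"
    proof (rule bounded_bilinear.bounded_uniform_limit[OF bounded_bilinear_blinfun_apply uniform_limit_const uS])
      show "bounded ((\<lambda>s. A p (s * t)) ` cbox 0 1)"
        by (intro compact_imp_bounded compact_continuous_image continuous_on_subset[OF contA]) auto
      show "bounded ((\<lambda>s. y p (s * t)) ` cbox 0 1)"
        by (intro compact_imp_bounded compact_continuous_image continuous_on_subset[OF conty]) auto
    qed
    have cY: "continuous_on (cbox 0 1) (\<lambda>s. blinfun_apply (A p (s * t)) (?Y n p (s * t)))" for n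
      by (intro blinfun.continuous_on continuous_on_subset[OF contA] continuous_on_subset[OF contY]) auto
    have cS: "continuous_on (cbox 0 1) (\<lambda>s. blinfun_apply (A p (s * t)) (?S n (s * t)))" for n
      unfolding blinfun.sum_right by (intro continuous_on_sum cY)
    obtain I J where
      I: "\<And>n. ((\<lambda>s. blinfun_apply (A p (s * t)) (?S n (s * t))) has_integral I n) (cbox 0 1)" and
      J: "((\<lambda>s. blinfun_apply (A p (s * t)) (y p (s * t))) has_integral J) (cbox 0 1)" and
      IJ: "I \<longlonglongrightarrow> J"
      by (rule uniform_limit_integral_cbox[OF ul cS trivial_limit_sequentially]) (rule that)
    have "?S (Suc n) t = y0 + t *\<^sub>R I n" for n
    proof -
      have "I n = integral (cbox 0 1) (\<lambda>s. \<Sum>i<n. blinfun_apply (A p (s * t)) (?Y i p (s * t)))"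
        using I[of n] by (simp add: blinfun.sum_right integral_unique)
      also have "\<dots> = (\<Sum>i<n. integral (cbox 0 1) (\<lambda>s. blinfun_apply (A p (s * t)) (?Y i p (s * t))))"
        by (intro integral_sum integrable_continuous cY) simp
      finally show ?thesis
        by (simp add: sum.lessThan_Suc_shift scaleR_sum_right del: sum.lessThan_Suc)
    qed
    then have "(\<lambda>n. ?S (Suc n) t) \<longlonglongrightarrow> y0 + t *\<^sub>R J"
      using IJ by (auto intro!: tendsto_intros)
    moreover have "(\<lambda>n. ?S (Suc n) t) \<longlonglongrightarrow> y p t"
      by (rule LIMSEQ_Suc[OF tS])
    ultimately have "y p t = y0 + t *\<^sub>R J" by (rule LIMSEQ_unique[symmetric])
    then show ?thesis using J by (simp add: integral_unique)
  qed
  have "(y p has_vector_derivative blinfun_apply (A p t) (y p t)) (at t)" for p t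
  proof -
    have "continuous_on UNIV (\<lambda>s. blinfun_apply (A p s) (y p s))"
      using contA[of p 1] conty[of p 1] by (intro blinfun.continuous_on) simp_all
    from has_vector_derivative_add[OF has_vector_derivative_const has_vector_derivative_scaled_integral[OF this, of t], of y0]
    have "((\<lambda>t. y0 + t *\<^sub>R integral {0..1} (\<lambda>s. blinfun_apply (A p (s * t)) (y p (s * t))))
       has_vector_derivative blinfun_apply (A p t) (y p t)) (at t)"
      by simp
    then show ?thesis by (simp add: fix_eq[symmetric])
  qed
  moreover have "y p 0 = y0" for p using fix_eq[of p 0] by simp
  ultimately show ?thesis using that cont by blast
qed

text \<open>Gronwall's argument: if \<open>M\<close> bounds the norm of \<open>A\<close> on \<open>[t0, t]\<close>, then \<open>\<parallel>z\<parallel>\<^sup>2 exp(-2 M s)\<close> does not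
  increase there.\<close>

lemma linear_ode_unique_forward:
  fixes z :: "real \<Rightarrow> 'a::real_inner"
  assumes A: "continuous_on UNIV A"
    and z: "\<And>t. (z has_vector_derivative blinfun_apply (A t) (z t)) (at t)"
    and "z t0 = 0" and "t0 \<le> t"
  shows "z t = 0"
proof -
  have "bounded (A ` {t0..t})"
    by (intro compact_imp_bounded compact_continuous_image continuous_on_subset[OF A]) auto
  then obtain M where M: "\<And>s. s \<in> {t0..t} \<Longrightarrow> norm (A s) \<le> M"
    unfolding bounded_iff by blast
  let ?e = "\<lambda>s. (z s \<bullet> z s) * exp (- 2 * M * s)"
  have "?e t \<le> ?e t0"
  proof (rule DERIV_nonpos_imp_nonincreasing[OF \<open>t0 \<le> t\<close>])
    fix s assume s: "t0 \<le> s" "s \<le> t"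
    have d: "((\<lambda>s. z s \<bullet> z s) has_real_derivative 2 * (z s \<bullet> blinfun_apply (A s) (z s))) (at s)"
    proof -
      have "((\<lambda>s. z s \<bullet> z s) has_derivative (\<lambda>h. z s \<bullet> (h *\<^sub>R blinfun_apply (A s) (z s)) + (h *\<^sub>R blinfun_apply (A s) (z s)) \<bullet> z s)) (at s)"
        using z[of s] unfolding has_vector_derivative_def by (intro has_derivative_inner)
      then show ?thesis
        unfolding has_field_derivative_def
        by (rule has_derivative_eq_rhs) (auto simp: inner_commute algebra_simps)
    qed
    have "z s \<bullet> blinfun_apply (A s) (z s) \<le> norm (z s) * norm (blinfun_apply (A s) (z s))"
      by (rule norm_cauchy_schwarz)
    also have "\<dots> \<le> norm (z s) * (norm (A s) * norm (z s))"
      by (intro mult_left_mono norm_blinfun) auto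
    also have "\<dots> \<le> norm (z s) * (M * norm (z s))"
      by (intro mult_left_mono mult_right_mono M) (use s in auto)
    also have "\<dots> = M * (z s \<bullet> z s)" by (simp add: dot_square_norm power2_eq_square)
    finally have le: "2 * (z s \<bullet> blinfun_apply (A s) (z s)) - 2 * M * (z s \<bullet> z s) \<le> 0" by simp
    have "(?e has_real_derivative (2 * (z s \<bullet> blinfun_apply (A s) (z s)) - 2 * M * (z s \<bullet> z s)) * exp (- 2 * M * s)) (at s)"
    proof -
      have "((\<lambda>s. exp (- 2 * M * s)) has_real_derivative exp (- 2 * M * s) * (- 2 * M)) (at s)"
        by (auto intro!: derivative_eq_intros)
      from DERIV_mult[OF d this] show ?thesis by (simp add: algebra_simps)
    qed
    then show "\<exists>y. (?e has_real_derivative y) (at s) \<and> y \<le> 0"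
      using le by (meson exp_ge_zero mult_nonpos_nonneg)
  qed
  then have "(z t \<bullet> z t) * exp (- 2 * M * t) \<le> 0" using \<open>z t0 = 0\<close> by simp
  then have "z t \<bullet> z t \<le> 0" by (simp only: mult_le_0_iff not_exp_le_zero exp_ge_zero) blast
  then show ?thesis by (metis inner_eq_zero_iff inner_ge_zero order_antisym)
qed

lemma linear_ode_unique:
  fixes z :: "real \<Rightarrow> 'a::real_inner"
  assumes A: "continuous_on UNIV A"
    and z: "\<And>t. (z has_vector_derivative blinfun_apply (A t) (z t)) (at t)"
    and 0: "z t0 = 0"
  shows "z t = 0"
proof (cases "t0 \<le> t")
  case False
  have "z (- (- t)) = 0"
  proof (rule linear_ode_unique_forward[where A="\<lambda>t. - A (- t)" and z="\<lambda>t. z (- t)" and ?t0.0 = "- t0"])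
    show "continuous_on UNIV (\<lambda>t. - A (- t))"
      by (intro continuous_intros continuous_on_compose2[OF A]) auto
    show "((\<lambda>t. z (- t)) has_vector_derivative blinfun_apply (- A (- s)) (z (- s))) (at s)" for s
    proof -
      have "(uminus has_vector_derivative (-1)) (at s)" by (auto intro!: derivative_eq_intros)
      from vector_diff_chain_at[OF this z] show ?thesis by (simp add: o_def blinfun.minus_left)
    qed
  qed (use 0 False in auto)
  then show ?thesis by simp
qed (use linear_ode_unique_forward assms in blast)

section \<open>Shooting for an unstable mode\<close>

text \<open>The system for \<open>(u, v)\<close> in the complex form \<open>w = u + \<i> v\<close>, with \<open>w'\<close> carried along as a second
  unknown. Since \<open>w - 2 cnj w = - u + 3 \<i> v\<close>, the real part reads \<open>u'' = \<omega> u - s V u + \<mu> v\<close> and the imaginary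
  part \<open>v'' = \<omega> v + 3 s V v - \<mu> u\<close>. The factor \<open>s\<close> switches the potential off; the equation is complex
  linear exactly where \<open>s V\<close> vanishes, and real linear in general.\<close>

definition mode_eq ::
  "real \<Rightarrow> (real \<Rightarrow> real) \<Rightarrow> real \<Rightarrow> real \<Rightarrow> (real \<Rightarrow> complex) \<Rightarrow> (real \<Rightarrow> complex) \<Rightarrow> bool" where
  "mode_eq \<omega> V \<mu> s w w' \<longleftrightarrow> (\<forall>t.
     (w has_vector_derivative w' t) (at t) \<and>
     (w' has_vector_derivative
        \<omega> *\<^sub>R w t - \<mu> *\<^sub>R (\<i> * w t) + (s * V t) *\<^sub>R (w t - 2 * cnj (w t))) (at t))"

lemma mode_eqD:
  assumes "mode_eq \<omega> V \<mu> s w w'"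
  shows "(w has_vector_derivative w' t) (at t)"
    "(w' has_vector_derivative
        \<omega> *\<^sub>R w t - \<mu> *\<^sub>R (\<i> * w t) + (s * V t) *\<^sub>R (w t - 2 * cnj (w t))) (at t)"
  using assms by (auto simp: mode_eq_def)

lemma mode_eq_lincomb:
  assumes 1: "mode_eq \<omega> V \<mu> s w w'" and 2: "mode_eq \<omega> V \<mu> s v v'"
  shows "mode_eq \<omega> V \<mu> s (\<lambda>t. a *\<^sub>R w t + b *\<^sub>R v t) (\<lambda>t. a *\<^sub>R w' t + b *\<^sub>R v' t)"
  unfolding mode_eq_def
proof (intro allI conjI)
  fix t
  note R = has_vector_derivative_add[OF bounded_linear.has_vector_derivative[OF bounded_linear_scaleR_right]
      bounded_linear.has_vector_derivative[OF bounded_linear_scaleR_right]]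
  show "((\<lambda>t. a *\<^sub>R w t + b *\<^sub>R v t) has_vector_derivative a *\<^sub>R w' t + b *\<^sub>R v' t) (at t)"
    by (rule R[OF mode_eqD(1)[OF 1] mode_eqD(1)[OF 2]])
  show "((\<lambda>t. a *\<^sub>R w' t + b *\<^sub>R v' t) has_vector_derivative
      \<omega> *\<^sub>R (a *\<^sub>R w t + b *\<^sub>R v t) - \<mu> *\<^sub>R (\<i> * (a *\<^sub>R w t + b *\<^sub>R v t)) +
      (s * V t) *\<^sub>R (a *\<^sub>R w t + b *\<^sub>R v t - 2 * cnj (a *\<^sub>R w t + b *\<^sub>R v t))) (at t)"
    using R[OF mode_eqD(2)[OF 1, of t] mode_eqD(2)[OF 2, of t], of a b]
    by (simp add: algebra_simps scaleR_conv_of_real)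
qed

lemma mode_eq_reflect:
  assumes w: "mode_eq \<omega> V \<mu> s w w'" and V: "\<And>t. V (c - t) = V t"
  shows "mode_eq \<omega> V \<mu> s (\<lambda>t. w (c - t)) (\<lambda>t. - w' (c - t))"
  unfolding mode_eq_def
proof (intro allI conjI)
  fix t
  have c: "((\<lambda>t. c - t) has_vector_derivative (-1)) (at t)"
    by (auto intro!: derivative_eq_intros)
  show "((\<lambda>t. w (c - t)) has_vector_derivative - w' (c - t)) (at t)"
    using vector_diff_chain_at[OF c mode_eqD(1)[OF w]] by (simp add: o_def)
  show "((\<lambda>t. - w' (c - t)) has_vector_derivative
      \<omega> *\<^sub>R w (c - t) - \<mu> *\<^sub>R (\<i> * w (c - t)) +
      (s * V t) *\<^sub>R (w (c - t) - 2 * cnj (w (c - t)))) (at t)"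
    using has_vector_derivative_minus[OF vector_diff_chain_at[OF c mode_eqD(2)[OF w]]] V[of t]
    by (simp add: o_def algebra_simps)
qed

lemma mode_eq_times_ii:
  assumes w: "mode_eq \<omega> V \<mu> 0 w w'"
  shows "mode_eq \<omega> V \<mu> 0 (\<lambda>t. \<i> * w t) (\<lambda>t. \<i> * w' t)"
  unfolding mode_eq_def
proof (intro allI conjI)
  fix t
  show "((\<lambda>t. \<i> * w t) has_vector_derivative \<i> * w' t) (at t)"
    by (rule bounded_linear.has_vector_derivative[OF bounded_linear_mult_right mode_eqD(1)[OF w]])
  show "((\<lambda>t. \<i> * w' t) has_vector_derivative
      \<omega> *\<^sub>R (\<i> * w t) - \<mu> *\<^sub>R (\<i> * (\<i> * w t)) + (0 * V t) *\<^sub>R (\<i> * w t - 2 * cnj (\<i> * w t))) (at t)"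
    using bounded_linear.has_vector_derivative[OF bounded_linear_mult_right mode_eqD(2)[OF w, of t], of \<i>]
    by (simp add: algebra_simps)
qed

definition mode_field ::
  "real \<Rightarrow> (real \<Rightarrow> real) \<Rightarrow> real \<times> real \<Rightarrow> real \<Rightarrow> (complex \<times> complex) \<Rightarrow>\<^sub>L (complex \<times> complex)" where
  "mode_field \<omega> V p t =
     Blinfun (\<lambda>y. (snd y, \<omega> *\<^sub>R fst y)) - fst p *\<^sub>R Blinfun (\<lambda>y. (0, \<i> * fst y))
     + (snd p * V t) *\<^sub>R Blinfun (\<lambda>y. (0, fst y - 2 * cnj (fst y)))"

lemma mode_field_apply:
  "blinfun_apply (mode_field \<omega> V p t) y =
     (snd y, \<omega> *\<^sub>R fst y - fst p *\<^sub>R (\<i> * fst y) + (snd p * V t) *\<^sub>R (fst y - 2 * cnj (fst y)))"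
proof -
  have "bounded_linear (\<lambda>y::complex \<times> complex. (snd y, \<omega> *\<^sub>R fst y))"
    by (intro bounded_linear_Pair bounded_linear_snd
        bounded_linear_compose[OF bounded_linear_scaleR_right bounded_linear_fst])
  moreover have "bounded_linear (\<lambda>y::complex \<times> complex. (0::complex, \<i> * fst y))"
    by (intro bounded_linear_Pair bounded_linear_zero
        bounded_linear_compose[OF bounded_linear_mult_right bounded_linear_fst])
  moreover have "bounded_linear (\<lambda>y::complex \<times> complex. (0::complex, fst y - 2 * cnj (fst y)))"
    by (intro bounded_linear_Pair bounded_linear_zero bounded_linear_sub bounded_linear_fst
        bounded_linear_compose[OF bounded_linear_mult_right]
        bounded_linear_compose[OF bounded_linear_cnj bounded_linear_fst])
  ultimately show ?thesis
    by (simp add: mode_field_def blinfun.bilinear_simps bounded_linear_Blinfun_apply)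
qed

lemma continuous_on_mode_field:
  assumes "continuous_on UNIV V"
  shows "continuous_on UNIV (\<lambda>(p, t). mode_field \<omega> V p t)"
proof -
  have "continuous_on UNIV (\<lambda>z::(real \<times> real) \<times> real. V (snd z))"
    by (rule continuous_on_compose2[OF assms]) (auto intro: continuous_on_snd)
  then show ?thesis
    unfolding mode_field_def case_prod_unfold by (intro continuous_intros)
qed

lemma mode_eq_exists:
  assumes "continuous_on UNIV V"
  obtains w w' where "continuous_on UNIV (\<lambda>(p, t). w' p t :: complex)"
    "\<And>\<mu> s. mode_eq \<omega> V \<mu> s (w (\<mu>, s)) (w' (\<mu>, s))"
    "\<And>p. w p 0 = c" "\<And>p. w' p 0 = 0"
proof -
  obtain y where y: "continuous_on UNIV (\<lambda>(p, t). y p t)" "\<And>p. y p 0 = (c, 0 :: complex)"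
    and dy: "\<And>p t. (y p has_vector_derivative blinfun_apply (mode_field \<omega> V p t) (y p t)) (at t)"
    using linear_ode_solution_exists[OF continuous_on_mode_field[OF assms], of "(c, 0)"] by blast
  show ?thesis
  proof
    show "continuous_on UNIV (\<lambda>(p, t). snd (y p t))"
      using continuous_on_snd[OF y(1)] by (simp add: case_prod_unfold)
    fix \<mu> s
    show "mode_eq \<omega> V \<mu> s (\<lambda>t. fst (y (\<mu>, s) t)) (\<lambda>t. snd (y (\<mu>, s) t))"
      unfolding mode_eq_def
      using bounded_linear.has_vector_derivative[OF bounded_linear_fst dy, of "(\<mu>, s)"]
        bounded_linear.has_vector_derivative[OF bounded_linear_snd dy, of "(\<mu>, s)"]
      by (simp add: mode_field_apply)
  qed (simp_all add: y)
qed

lemma mode_eq_unique: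
  assumes V: "continuous_on UNIV V"
    and w: "mode_eq \<omega> V \<mu> s w w'" and v: "mode_eq \<omega> V \<mu> s v v'"
    and init: "w t0 = v t0" "w' t0 = v' t0"
  shows "w t = v t" "w' t = v' t"
proof -
  have d: "mode_eq \<omega> V \<mu> s (\<lambda>t. 1 *\<^sub>R w t + (-1) *\<^sub>R v t) (\<lambda>t. 1 *\<^sub>R w' t + (-1) *\<^sub>R v' t)"
    by (rule mode_eq_lincomb[OF w v])
  have "continuous_on UNIV (mode_field \<omega> V (\<mu>, s))"
    using continuous_on_compose2[OF continuous_on_mode_field[OF V], of UNIV "\<lambda>t. ((\<mu>, s), t)" \<omega>]
    by (simp add: continuous_on_Pair continuous_on_const continuous_on_id)
  from linear_ode_unique[OF this, of "\<lambda>t. (1 *\<^sub>R w t + (-1) *\<^sub>R v t, 1 *\<^sub>R w' t + (-1) *\<^sub>R v' t)" t0 t]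
  have "(1 *\<^sub>R w t + (-1) *\<^sub>R v t, 1 *\<^sub>R w' t + (-1) *\<^sub>R v' t) = 0"
    using has_vector_derivative_Pair[OF mode_eqD(1)[OF d] mode_eqD(2)[OF d]] init
    by (simp add: mode_field_apply zero_prod_def)
  then show "w t = v t" "w' t = v' t" by (auto simp: zero_prod_def)
qed

text \<open>For \<open>e = Im (cnj w * w')\<close> the equation gives
  \<open>e' = - \<mu> \<bar>w\<bar>\<^sup>2 - 2 s V Im ((cnj w)\<^sup>2) \<le> - (\<mu> - 2 V) \<bar>w\<bar>\<^sup>2\<close>, while the boundary conditions give
  \<open>e(0) = e(T) = 0\<close>. So a dominant \<open>\<mu>\<close> is incompatible with a nontrivial solution.\<close>

lemma mode_eq_no_neumann:
  assumes w: "mode_eq \<omega> V \<mu> s w w'" and T: "T > 0" and s: "0 \<le> s" "s \<le> 1"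
    and V: "\<And>t. 0 \<le> V t" and \<mu>: "\<And>t. 0 \<le> t \<Longrightarrow> t \<le> T \<Longrightarrow> 2 * V t < \<mu>"
    and w0: "w' 0 = 0" and wT: "w' T = 0"
  shows "w 0 = 0"
proof (rule ccontr)
  assume nz: "w 0 \<noteq> 0"
  let ?e = "\<lambda>t. Im (cnj (w t) * w' t)"
  let ?d = "\<lambda>t. - \<mu> * (cmod (w t))\<^sup>2 - 2 * (s * V t) * Im ((cnj (w t))\<^sup>2)"
  have de: "(?e has_real_derivative ?d t) (at t)" for t
  proof -
    have "((\<lambda>t. cnj (w t) * w' t) has_vector_derivative
       cnj (w t) * (\<omega> *\<^sub>R w t - \<mu> *\<^sub>R (\<i> * w t) + (s * V t) *\<^sub>R (w t - 2 * cnj (w t))) + cnj (w' t) * w' t) (at t)"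
      by (rule has_vector_derivative_mult[OF bounded_linear.has_vector_derivative[OF bounded_linear_cnj mode_eqD(1)[OF w]] mode_eqD(2)[OF w]])
    from bounded_linear.has_vector_derivative[OF bounded_linear_Im this]
    show ?thesis
      unfolding has_real_derivative_iff_has_vector_derivative
      unfolding cmod_power2
      by (rule has_vector_derivative_eq_rhs) (simp add: power2_eq_square algebra_simps)
  qed
  have le: "?d t \<le> - (\<mu> - 2 * V t) * (cmod (w t))\<^sup>2" for t
  proof -
    have "- Im ((cnj (w t))\<^sup>2) \<le> (cmod (w t))\<^sup>2"
      using abs_Im_le_cmod[of "(cnj (w t))\<^sup>2"] by (simp add: norm_power)
    then have "2 * (s * V t) * (- Im ((cnj (w t))\<^sup>2)) \<le> 2 * (s * V t) * (cmod (w t))\<^sup>2"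
      using s V[of t] by (intro mult_left_mono) auto
    also have "\<dots> \<le> 2 * (1 * V t) * (cmod (w t))\<^sup>2"
      using s V[of t] by (intro mult_right_mono mult_left_mono) auto
    finally have "- (2 * (s * V t) * Im ((cnj (w t))\<^sup>2)) \<le> 2 * V t * (cmod (w t))\<^sup>2"
      by simp
    moreover have "- (\<mu> - 2 * V t) * (cmod (w t))\<^sup>2 = - \<mu> * (cmod (w t))\<^sup>2 + 2 * V t * (cmod (w t))\<^sup>2"
      by (simp only: minus_diff_eq left_diff_distrib)
    ultimately show ?thesis by linarith
  qed
  have "- (\<mu> - 2 * V 0) * (cmod (w 0))\<^sup>2 < 0"
    using \<mu>[of 0] T nz by (intro mult_neg_pos) auto
  with le[of 0] have "?d 0 < 0" by (rule le_less_trans)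
  from DERIV_neg_dec_right[OF de this]
  obtain d where d: "d > 0" "\<And>h. 0 < h \<Longrightarrow> h < d \<Longrightarrow> ?e (0 + h) < ?e 0" by blast
  define h where "h = min (d / 2) T"
  have h: "0 < h" "h < d" "h \<le> T" using d T by (auto simp: h_def)
  have "?e T \<le> ?e h"
  proof (rule DERIV_nonpos_imp_nonincreasing[OF h(3)])
    fix t assume t: "h \<le> t" "t \<le> T"
    then have "- (\<mu> - 2 * V t) * (cmod (w t))\<^sup>2 \<le> 0"
      using \<mu>[of t] h by (intro mult_nonpos_nonneg) auto
    then show "\<exists>y. (?e has_real_derivative y) (at t) \<and> y \<le> 0"
      using de le order_trans by blast
  qed
  with d(2)[OF h(1,2)] w0 wT show False by simp
qed

text \<open>The product \<open>v v'\<close> has derivative \<open>(\<omega> + P) v\<^sup>2 + v'\<^sup>2\<close>; hence it is increasing, \<open>v\<^sup>2\<close> stays at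
  least \<open>1\<close>, and \<open>v\<close> keeps the sign it has at \<open>0\<close>.\<close>

lemma convex_solution_increasing:
  fixes v v' :: "real \<Rightarrow> real"
  assumes v: "\<And>t. (v has_real_derivative v' t) (at t)"
    and v': "\<And>t. (v' has_real_derivative (\<omega> + P t) * v t) (at t)"
    and \<omega>: "\<omega> > 0" and P: "\<And>t. P t \<ge> 0" and T: "T > 0"
    and init: "v 0 = 1" "v' 0 = 0"
  shows "v' T > 0"
proof -
  have d: "((\<lambda>t. v t * v' t) has_real_derivative (\<omega> + P t) * (v t)\<^sup>2 + (v' t)\<^sup>2) (at t)" for t
    using DERIV_mult[OF v v', of t] by (simp add: power2_eq_square algebra_simps)
  have vv': "0 \<le> v t * v' t" if "0 \<le> t" for t
  proof -
    have "v 0 * v' 0 \<le> v t * v' t"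
    proof (rule DERIV_nonneg_imp_nondecreasing[OF that])
      fix t
      show "\<exists>y. ((\<lambda>t. v t * v' t) has_real_derivative y) (at t) \<and> 0 \<le> y"
        using d[of t] \<omega> P[of t] by (auto intro!: exI[of _ "(\<omega> + P t) * (v t)\<^sup>2 + (v' t)\<^sup>2"])
    qed
    then show ?thesis using init by simp
  qed
  have v2: "1 \<le> (v t)\<^sup>2" if "0 \<le> t" for t
  proof -
    have "(v 0)\<^sup>2 \<le> (v t)\<^sup>2"
    proof (rule DERIV_nonneg_imp_nondecreasing[OF that])
      fix u :: real assume "0 \<le> u"
      then have "0 \<le> 2 * (v u * v' u)" using vv'[of u] by linarith
      moreover have "((\<lambda>t. (v t)\<^sup>2) has_real_derivative 2 * (v u * v' u)) (at u)"
        using DERIV_power[OF v[of u], of 2] by (simp add: algebra_simps)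
      ultimately show "\<exists>y. ((\<lambda>t. (v t)\<^sup>2) has_real_derivative y) (at u) \<and> 0 \<le> y"
        by blast
    qed
    then show ?thesis using init by simp
  qed
  have "v 0 * v' 0 < v T * v' T"
  proof (rule DERIV_pos_imp_increasing_open[OF T])
    fix u :: real assume u: "0 < u" "u < T"
    have "0 < (\<omega> + P u) * (v u)\<^sup>2"
      using v2[of u] u \<omega> P[of u] by (intro mult_pos_pos) (auto simp: add_pos_nonneg)
    then show "\<exists>y. ((\<lambda>t. v t * v' t) has_real_derivative y) (at u) \<and> 0 < y"
      using d[of u] by (auto intro!: exI[of _ "(\<omega> + P u) * (v u)\<^sup>2 + (v' u)\<^sup>2"] simp: add_pos_nonneg)
  next
    show "continuous_on {0..T} (\<lambda>t. v t * v' t)"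
      by (rule DERIV_continuous_on) (rule has_field_derivative_at_within[OF d])
  qed
  then have pos: "0 < v T * v' T" using init by simp
  have "v T > 0"
  proof (rule ccontr)
    assume "\<not> v T > 0"
    moreover have "continuous_on {0..T} v"
      by (rule DERIV_continuous_on) (rule has_field_derivative_at_within[OF v])
    ultimately have "\<exists>x\<ge>0. x \<le> T \<and> v x = 0"
      using T init by (intro IVT2') auto
    then obtain x where "0 \<le> x" "v x = 0" by blast
    with v2[of x] show False by simp
  qed
  with pos show ?thesis by (simp add: zero_less_mult_iff)
qed


lemma parallel_complex_dependent:
  fixes x y :: complex
  assumes "Im (cnj x * y) = 0"
  obtains a b :: real where "a *\<^sub>R x + b *\<^sub>R y = 0" "(a, b) \<noteq> (0, 0)"
proof (cases "x = 0")
  case True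
  then show ?thesis using that[of 1 0] by simp
next
  case False
  have "Re (cnj x * y) *\<^sub>R x + (- (cmod x)\<^sup>2) *\<^sub>R y = 0"
  proof -
    have "complex_of_real (Re (cnj x * y)) = cnj x * y" using assms by (simp add: complex_eq_iff)
    then have "Re (cnj x * y) *\<^sub>R x = (x * cnj x) * y" by (simp add: scaleR_conv_of_real)
    then show ?thesis by (simp add: complex_norm_square[symmetric] scaleR_conv_of_real)
  qed
  then show ?thesis by (rule that) (use False in simp)
qed

text \<open>The function \<open>\<psi>\<close> is the kernel element of \<open>-\<partial>\<^sup>2 + \<omega> - V\<close>. Its negative slope at \<open>T\<close> is the one
  negative factor of the shooting determinant at \<open>\<mu> = 0\<close>.\<close>

lemma unstable_mode_exists:
  fixes V \<psi> \<psi>' :: "real \<Rightarrow> real"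
  assumes V: "continuous_on UNIV V" "\<And>t. 0 \<le> V t"
    and sym: "\<And>t. V (- t) = V t" "\<And>t. V (2 * T - t) = V t"
    and pos: "\<omega> > 0" "T > 0"
    and \<psi>: "\<And>t. (\<psi> has_real_derivative \<psi>' t) (at t)"
      "\<And>t. (\<psi>' has_real_derivative (\<omega> - V t) * \<psi> t) (at t)"
      "\<psi> 0 > 0" "\<psi>' 0 = 0" "\<psi>' T < 0"
  obtains \<mu> w w' where "\<mu> > 0" "mode_eq \<omega> V \<mu> 1 w w'" "w 0 \<noteq> 0" "\<And>t. w (t + 2 * T) = w t"
proof -
  obtain w1 w1' where w1: "continuous_on UNIV (\<lambda>(p, t). w1' p t :: complex)"
    "\<And>\<mu> s. mode_eq \<omega> V \<mu> s (w1 (\<mu>, s)) (w1' (\<mu>, s))" "\<And>p. w1 p 0 = 1" "\<And>p. w1' p 0 = 0"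
    using mode_eq_exists[OF V(1), where c=1] by metis
  obtain w2 w2' where w2: "continuous_on UNIV (\<lambda>(p, t). w2' p t :: complex)"
    "\<And>\<mu> s. mode_eq \<omega> V \<mu> s (w2 (\<mu>, s)) (w2' (\<mu>, s))" "\<And>p. w2 p 0 = \<i>" "\<And>p. w2' p 0 = 0"
    using mode_eq_exists[OF V(1), where c=\<i>] by metis
  \<comment> \<open>The columns of the real linear map \<open>w(0) \<mapsto> w'(T)\<close> are the images of \<open>1\<close> and \<open>\<i>\<close>, and \<open>D\<close> is its determinant.\<close>
  define D where "D = (\<lambda>p. Im (cnj (w1' p T) * w2' p T))"
  have contD: "continuous_on UNIV D"
  proof -
    have pT: "continuous_on UNIV (\<lambda>p::real \<times> real. (p, T))" by (intro continuous_intros)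
    show ?thesis unfolding D_def
      using continuous_on_compose2[OF w1(1) pT] continuous_on_compose2[OF w2(1) pT]
      by (intro continuous_intros) simp_all
  qed
  have kernel: "\<exists>w w'. mode_eq \<omega> V \<mu> s w w' \<and> w 0 \<noteq> 0 \<and> w' 0 = 0 \<and> w' T = 0"
    if "D (\<mu>, s) = 0" for \<mu> s
  proof -
    obtain a b where ab: "a *\<^sub>R w1' (\<mu>, s) T + b *\<^sub>R w2' (\<mu>, s) T = 0" "(a, b) \<noteq> (0, 0)"
      using parallel_complex_dependent \<open>D (\<mu>, s) = 0\<close> unfolding D_def by blast
    show ?thesis
      using mode_eq_lincomb[OF w1(2) w2(2), of \<mu> s a b] ab w1(3,4) w2(3,4)
      by (intro exI conjI) (auto simp: complex_eq_iff)
  qed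
  have D0: "D (0, 1) < 0"
  proof -
    define u u' where "u = (\<lambda>t. complex_of_real (\<psi> t / \<psi> 0))" and "u' = (\<lambda>t. complex_of_real (\<psi>' t / \<psi> 0))"
    have of_real: "((\<lambda>t. complex_of_real (f t / \<psi> 0)) has_vector_derivative complex_of_real (f' / \<psi> 0)) (at t)"
      if "(f has_real_derivative f') (at t)" for f f' t
      using bounded_linear.has_vector_derivative[OF bounded_linear_of_real]
        DERIV_cdivide[OF that] unfolding has_real_derivative_iff_has_vector_derivative by blast
    have "mode_eq \<omega> V 0 1 u u'"
      unfolding mode_eq_def u_def u'_def
      using of_real[OF \<psi>(1)] of_real[OF \<psi>(2)]
      by (auto simp: scaleR_conv_of_real algebra_simps diff_divide_distrib)
    then have z1: "w1' (0, 1) T = u' T"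
      by (rule mode_eq_unique(2)[OF V(1) w1(2), where ?t0.0 = 0]) (use w1 \<psi> in \<open>auto simp: u_def u'_def\<close>)
    define v v' where "v = (\<lambda>t. Im (w2 (0, 1) t))" and "v' = (\<lambda>t. Im (w2' (0, 1) t))"
    have "(v has_real_derivative v' t) (at t)" for t
      unfolding v_def v'_def has_real_derivative_iff_has_vector_derivative
      by (rule bounded_linear.has_vector_derivative[OF bounded_linear_Im mode_eqD(1)[OF w2(2)]])
    moreover have "(v' has_real_derivative (\<omega> + 3 * V t) * v t) (at t)" for t
      unfolding v_def v'_def has_real_derivative_iff_has_vector_derivative
      using bounded_linear.has_vector_derivative[OF bounded_linear_Im mode_eqD(2)[OF w2(2)], of 0 1 t]
      by (simp add: algebra_simps)
    ultimately have "v' T > 0"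
      by (rule convex_solution_increasing[where P="\<lambda>t. 3 * V t"]) (use pos V w2 in \<open>auto simp: v_def v'_def\<close>)
    then show ?thesis
      using \<psi> by (simp add: D_def z1 u'_def v'_def mult_neg_pos divide_neg_pos)
  qed
  obtain M where M: "\<And>t. t \<in> {0..T} \<Longrightarrow> norm (V t) \<le> M"
  proof -
    have "bounded (V ` {0..T})"
      by (intro compact_imp_bounded compact_continuous_image continuous_on_subset[OF V(1)]) auto
    then show ?thesis using that unfolding bounded_iff by blast
  qed
  define \<Lambda> where "\<Lambda> = 2 * M + 1"
  have \<Lambda>: "2 * V t < \<Lambda>" if "0 \<le> t" "t \<le> T" for t
    using M[of t] V(2)[of t] that by (simp add: \<Lambda>_def)
  have "\<Lambda> > 0" using \<Lambda>[of 0] V(2)[of 0] pos by simp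
  have nz: "D (\<Lambda>, s) \<noteq> 0" if "0 \<le> s" "s \<le> 1" for s
    using kernel[of \<Lambda> s] mode_eq_no_neumann[where V=V and \<mu>=\<Lambda>, OF _ pos(2) that V(2) \<Lambda>] by blast
  \<comment> \<open>Without potential, multiplication by \<open>\<i>\<close> maps the first solution to the second.\<close>
  have D1: "D (\<Lambda>, 0) > 0"
  proof -
    have "w2' (\<Lambda>, 0) T = \<i> * w1' (\<Lambda>, 0) T"
      by (rule mode_eq_unique(2)[OF V(1) w2(2) mode_eq_times_ii[OF w1(2)], where ?t0.0 = 0])
        (use w1 w2 in auto)
    then have "D (\<Lambda>, 0) = (cmod (w1' (\<Lambda>, 0) T))\<^sup>2"
      unfolding D_def cmod_power2 by (simp add: power2_eq_square)
    moreover have "D (\<Lambda>, 0) \<noteq> 0" using nz by simp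
    ultimately show ?thesis by (metis zero_le_power2 less_eq_real_def)
  qed
  \<comment> \<open>The sign survives while the potential is switched on, since \<open>D(\<Lambda>, s)\<close> never vanishes.\<close>
  have D2: "D (\<Lambda>, 1) > 0"
  proof (rule ccontr)
    assume "\<not> D (\<Lambda>, 1) > 0"
    moreover have "continuous_on {0..1} (\<lambda>s. D (\<Lambda>, s))"
      by (rule continuous_on_compose2[OF contD]) (auto intro!: continuous_intros)
    ultimately obtain s where "0 \<le> s" "s \<le> 1" "D (\<Lambda>, s) = 0"
      using IVT2'[of "\<lambda>s. D (\<Lambda>, s)" 1 0 0] D1 by force
    with nz show False by blast
  qed
  have "continuous_on {0..\<Lambda>} (\<lambda>\<mu>. D (\<mu>, 1))"
    by (rule continuous_on_compose2[OF contD]) (auto intro!: continuous_intros)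
  then obtain \<mu> where \<mu>: "0 \<le> \<mu>" "D (\<mu>, 1) = 0"
    using IVT'[of "\<lambda>\<mu>. D (\<mu>, 1)" 0 0 \<Lambda>] D0 D2 \<open>\<Lambda> > 0\<close> by force
  have "\<mu> > 0" using \<mu> D0 by (cases "\<mu> = 0") auto
  obtain w w' where w: "mode_eq \<omega> V \<mu> 1 w w'" "w 0 \<noteq> 0" "w' 0 = 0" "w' T = 0"
    using kernel[OF \<mu>(2)] by blast
  \<comment> \<open>The reflections about \<open>0\<close> and \<open>T\<close> preserve the equation and the initial data there; their composition is the shift by \<open>2 T\<close>.\<close>
  have even: "w (0 - t) = w t" for t
    by (rule mode_eq_unique(1)[OF V(1) mode_eq_reflect[OF w(1)] w(1), where ?t0.0 = 0])
      (use sym w in auto)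
  have "w (2 * T - t) = w t" for t
    by (rule mode_eq_unique(1)[OF V(1) mode_eq_reflect[OF w(1)] w(1), where ?t0.0 = T])
      (use sym w in auto)
  from this[of "- t" for t] even have "w (t + 2 * T) = w t" for t by (simp add: add.commute)
  with \<open>\<mu> > 0\<close> w(1,2) show ?thesis by (rule that)
qed

section \<open>The cnoidal profile as a solution of an ordinary differential equation\<close>

lemma elliptic_radicand_pos:
  fixes k t :: real
  assumes "0 < k" "k < 1"
  shows "0 < 1 - k\<^sup>2 * (sin t)\<^sup>2"
proof -
  have "k\<^sup>2 * (sin t)\<^sup>2 \<le> k\<^sup>2 * 1"
    using abs_sin_le_one[of t] by (intro mult_left_mono) (auto simp: abs_square_le_1)
  also have "k\<^sup>2 < 1" using assms by (simp add: power_less_one_iff)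
  finally show ?thesis by simp
qed

lemma ellipticF_has_derivative:
  assumes "0 < k" "k < 1"
  shows "(ellipticF k has_real_derivative 1 / sqrt (1 - k\<^sup>2 * (sin x)\<^sup>2)) (at x)"
proof -
  let ?X = "\<bar>x\<bar> + 1"
  have "continuous_on {-?X..?X} (\<lambda>t. 1 / sqrt (1 - k\<^sup>2 * (sin t)\<^sup>2))"
    using elliptic_radicand_pos[OF assms] by (intro continuous_intros) (auto simp: less_imp_neq[symmetric])
  then have "((\<lambda>u. LBINT t=ereal 0..ereal u. 1 / sqrt (1 - k\<^sup>2 * (sin t)\<^sup>2)) has_vector_derivative
      1 / sqrt (1 - k\<^sup>2 * (sin x)\<^sup>2)) (at x within {-?X..?X})"
    by (intro interval_integral_FTC2) auto
  moreover have "at x within {-?X..?X} = at x" by (intro at_within_Icc_at) auto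
  moreover have "ellipticF k = (\<lambda>u. LBINT t=ereal 0..ereal u. 1 / sqrt (1 - k\<^sup>2 * (sin t)\<^sup>2))"
    by (simp add: ellipticF_def fun_eq_iff zero_ereal_def)
  ultimately show ?thesis by (simp add: has_real_derivative_iff_has_vector_derivative)
qed

lemma ellipticF_0: "ellipticF k 0 = 0"
  by (simp add: ellipticF_def zero_ereal_def)

lemma ellipticF_less:
  assumes "0 < k" "k < 1" and "x < y"
  shows "ellipticF k x < ellipticF k y"
proof (rule DERIV_pos_imp_increasing[OF \<open>x < y\<close>])
  fix t :: real
  show "\<exists>z. (ellipticF k has_real_derivative z) (at t) \<and> 0 < z"
    using ellipticF_has_derivative[OF assms(1,2)] elliptic_radicand_pos[OF assms(1,2)]
    by (meson zero_less_divide_1_iff real_sqrt_gt_zero)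
qed

lemma ellipticF_minus:
  assumes "0 < k" "k < 1"
  shows "ellipticF k (- x) = - ellipticF k x"
proof -
  have "((\<lambda>x. ellipticF k (- x) + ellipticF k x) has_real_derivative 0) (at t)" for t
  proof -
    have "((\<lambda>x. ellipticF k (- x)) has_real_derivative 1 / sqrt (1 - k\<^sup>2 * (sin (- t))\<^sup>2) * (-1)) (at t)"
      by (rule DERIV_chain2[OF ellipticF_has_derivative[OF assms]]) (auto intro!: derivative_eq_intros)
    from DERIV_add[OF this ellipticF_has_derivative[OF assms]] show ?thesis by simp
  qed
  from DERIV_isconst_all[OF allI[OF this], of x 0] show ?thesis by (simp add: ellipticF_0)
qed

text \<open>The integrand is \<open>pi\<close>-periodic, so the difference is constant; oddness evaluates it at \<open>- pi / 2\<close>.\<close>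

lemma ellipticF_add_pi:
  assumes "0 < k" "k < 1"
  shows "ellipticF k (x + pi) = ellipticF k x + 2 * ellipticK k"
proof -
  have "((\<lambda>x. ellipticF k (x + pi) - ellipticF k x) has_real_derivative 0) (at t)" for t
  proof -
    have "((\<lambda>x. ellipticF k (x + pi)) has_real_derivative 1 / sqrt (1 - k\<^sup>2 * (sin (t + pi))\<^sup>2) * 1) (at t)"
      by (rule DERIV_chain2[OF ellipticF_has_derivative[OF assms]]) (auto intro!: derivative_eq_intros)
    from DERIV_diff[OF this ellipticF_has_derivative[OF assms]] show ?thesis by simp
  qed
  from DERIV_isconst_all[OF allI[OF this], of x "- (pi / 2)"]
  show ?thesis using ellipticF_minus[OF assms, of "pi / 2"] by (simp add: ellipticK_def)
qed

text \<open>The integrand is at least \<open>1\<close>. The bound makes \<open>ellipticF k\<close> onto, so that the amplitude is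
  a genuine inverse.\<close>

lemma ellipticF_ge:
  assumes "0 < k" "k < 1" and "0 \<le> x"
  shows "x \<le> ellipticF k x"
proof -
  have "ellipticF k 0 - 0 \<le> ellipticF k x - x"
  proof (rule DERIV_nonneg_imp_nondecreasing[OF \<open>0 \<le> x\<close>])
    fix t :: real
    have "((\<lambda>x. ellipticF k x - x) has_real_derivative 1 / sqrt (1 - k\<^sup>2 * (sin t)\<^sup>2) - 1) (at t)"
      by (intro DERIV_diff ellipticF_has_derivative assms DERIV_ident)
    moreover have "1 \<le> 1 / sqrt (1 - k\<^sup>2 * (sin t)\<^sup>2)"
      using elliptic_radicand_pos[OF assms(1,2), of t] by (simp add: le_divide_eq)
    ultimately show "\<exists>y. ((\<lambda>x. ellipticF k x - x) has_real_derivative y) (at t) \<and> 0 \<le> y"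
      by (intro exI conjI) auto
  qed
  then show ?thesis by (simp add: ellipticF_0)
qed

lemma ellipticK_pos:
  assumes "0 < k" "k < 1"
  shows "ellipticK k > 0"
  using ellipticF_less[OF assms, of 0 "pi / 2"] by (simp add: ellipticK_def ellipticF_0)

lemma isCont_ellipticF: "0 < k \<Longrightarrow> k < 1 \<Longrightarrow> isCont (ellipticF k) x"
  using ellipticF_has_derivative DERIV_isCont by blast

lemma jacobi_am_ellipticF:
  assumes "0 < k" "k < 1"
  shows "jacobi_am (ellipticF k x) k = x"
  unfolding jacobi_am_def
proof (rule the_equality)
  fix y assume "ellipticF k y = ellipticF k x"
  then show "y = x"
    using ellipticF_less[OF assms, of x y] ellipticF_less[OF assms, of y x] by (cases x y rule: linorder_cases) auto
qed simp

lemma ellipticF_jacobi_am: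
  assumes "0 < k" "k < 1"
  shows "ellipticF k (jacobi_am u k) = u"
proof -
  have "\<exists>x\<ge>- \<bar>u\<bar>. x \<le> \<bar>u\<bar> \<and> ellipticF k x = u"
  proof (rule IVT)
    show "ellipticF k (- \<bar>u\<bar>) \<le> u" "u \<le> ellipticF k \<bar>u\<bar>"
      using ellipticF_ge[OF assms, of "\<bar>u\<bar>"] ellipticF_minus[OF assms, of "\<bar>u\<bar>"] by auto
  qed (use isCont_ellipticF assms in auto)
  then obtain x where "ellipticF k x = u" by blast
  then show ?thesis using jacobi_am_ellipticF[OF assms, of x] by simp
qed

lemma jacobi_am_has_derivative:
  assumes "0 < k" "k < 1"
  shows "((\<lambda>u. jacobi_am u k) has_real_derivative sqrt (1 - k\<^sup>2 * (sin (jacobi_am u k))\<^sup>2)) (at u)"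
proof -
  let ?x = "jacobi_am u k"
  have "isCont (\<lambda>u. jacobi_am u k) (ellipticF k ?x)"
    by (rule isCont_inverse_function[where d = 1])
      (auto simp: jacobi_am_ellipticF isCont_ellipticF assms)
  then have "isCont (\<lambda>u. jacobi_am u k) u" by (simp add: ellipticF_jacobi_am assms)
  moreover have "1 / sqrt (1 - k\<^sup>2 * (sin ?x)\<^sup>2) \<noteq> 0"
    using elliptic_radicand_pos[OF assms, of ?x] by simp
  ultimately have "((\<lambda>u. jacobi_am u k) has_real_derivative inverse (1 / sqrt (1 - k\<^sup>2 * (sin ?x)\<^sup>2))) (at u)"
    by (intro DERIV_inverse_function[where f = "ellipticF k" and a = "u - 1" and b = "u + 1"]
        ellipticF_has_derivative ellipticF_jacobi_am assms) auto
  then show ?thesis by simp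
qed

lemma jacobi_am_simps:
  assumes "0 < k" "k < 1"
  shows "jacobi_am 0 k = 0" "jacobi_am (ellipticK k) k = pi / 2"
    "jacobi_am (- u) k = - jacobi_am u k"
    "jacobi_am (u + 2 * ellipticK k) k = jacobi_am u k + pi"
proof -
  note inv = jacobi_am_ellipticF[OF assms]
  show "jacobi_am 0 k = 0" using inv[of 0] by (simp add: ellipticF_0)
  show "jacobi_am (ellipticK k) k = pi / 2" using inv[of "pi / 2"] by (simp add: ellipticK_def)
  show "jacobi_am (- u) k = - jacobi_am u k"
    using inv[of "- jacobi_am u k"] by (simp add: ellipticF_minus ellipticF_jacobi_am assms)
  show "jacobi_am (u + 2 * ellipticK k) k = jacobi_am u k + pi"
    using inv[of "jacobi_am u k + pi"] by (simp add: ellipticF_add_pi ellipticF_jacobi_am assms)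
qed

lemma jacobi_sn_cn_minus:
  assumes "0 < k" "k < 1"
  shows "jacobi_sn (- u) k = - jacobi_sn u k" "jacobi_cn (- u) k = jacobi_cn u k"
  by (simp_all add: jacobi_sn_def jacobi_cn_def jacobi_am_simps assms)

lemma jacobi_sn_cn_half_period:
  assumes "0 < k" "k < 1"
  shows "jacobi_sn (u + 2 * ellipticK k) k = - jacobi_sn u k"
    "jacobi_cn (u + 2 * ellipticK k) k = - jacobi_cn u k"
  by (simp_all add: jacobi_sn_def jacobi_cn_def jacobi_am_simps assms)

lemma cnoidal_q_neg:
  assumes "0 < k" "k < 1"
  shows "cnoidal_q k < 0"
proof -
  have "k\<^sup>2 < 1" using assms by (simp add: power_less_one_iff)
  moreover have "0 \<le> k^4 - k\<^sup>2 + 1"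
  proof -
    have "k^4 - k\<^sup>2 + 1 = (k\<^sup>2 - 1/2)\<^sup>2 + 3/4" by (simp add: power2_eq_square power4_eq_xxxx algebra_simps)
    then show ?thesis by simp
  qed
  ultimately show ?thesis unfolding cnoidal_q_def by (smt (verit) real_sqrt_ge_zero)
qed

lemma cnoidal_profile_minus:
  assumes "0 < k" "k < 1"
  shows "cnoidal_profile L \<kappa> \<gamma> B k (- x) = cnoidal_profile L \<kappa> \<gamma> B k x"
  using jacobi_sn_cn_minus[OF assms, of "4 * ellipticK k / L * x"] by (simp add: cnoidal_profile_def)

lemma cnoidal_profile_half_period:
  assumes "0 < k" "k < 1" "L > 0"
  shows "cnoidal_profile L \<kappa> \<gamma> B k (x + L / 2) = - cnoidal_profile L \<kappa> \<gamma> B k x"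
proof -
  have "4 * ellipticK k / L * (x + L / 2) = 4 * ellipticK k / L * x + 2 * ellipticK k"
    using assms by (simp add: field_simps)
  then show ?thesis unfolding cnoidal_profile_def
    by (simp only: jacobi_sn_cn_half_period[OF assms(1,2)]) simp
qed

text \<open>The cnoidal profile solves its equation because of this identity, in which \<open>S = sn\<^sup>2\<close>, \<open>m = k\<^sup>2\<close>,
  \<open>r = sqrt (k^4 - k\<^sup>2 + 1)\<close> and \<open>2 - m + 2 r\<close> is the normalised fourth power of the amplitude.\<close>

lemma cnoidal_polynomial_identity:
  fixes S m r q :: real
  assumes r: "r\<^sup>2 = m\<^sup>2 - m + 1" and q: "q = -1 + m - r"
  shows "(q - 1) * ((1 - m * S) * (1 - q * S) - m * S * (1 - q * S) + 3 * q * S * (1 - m * S)) =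
    r * (1 - q * S)\<^sup>2 - (2 - m + 2 * r) * (1 - S)\<^sup>2"
  using r unfolding q by algebra

text \<open>With \<open>N = sqrt (1 - q sn\<^sup>2)\<close> and \<open>\<Delta> = dn\<close>, the derivative of \<open>A cn / N\<close> collapses to
  \<open>A b (q - 1) sn dn / N\<^sup>3\<close>, because \<open>q cn\<^sup>2 - N\<^sup>2 = q - 1\<close>. This also shows its sign at the zero \<open>L / 4\<close>
  of the profile.\<close>

lemma cnoidal_profile_ode:
  fixes L \<kappa> \<gamma> B k :: real
  assumes L: "L > 0" and k: "0 < k" "k < 1" and c: "\<kappa> + \<gamma> * B^3 > 0"
  defines "\<phi> \<equiv> cnoidal_profile L \<kappa> \<gamma> B k"
  obtains \<phi>' where "\<And>x. (\<phi> has_real_derivative \<phi>' x) (at x)"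
    "\<And>x. (\<phi>' has_real_derivative (cnoidal_frequency L k - (\<kappa> + \<gamma> * B^3) * (\<phi> x)^4) * \<phi> x) (at x)"
    "\<phi> 0 > 0" "\<phi>' 0 = 0" "\<phi>' (L / 4) < 0"
proof -
  define b where "b = 4 * ellipticK k / L"
  define q where "q = cnoidal_q k"
  define r where "r = sqrt (k^4 - k\<^sup>2 + 1)"
  define A where "A = 1 / root 4 (\<kappa> + \<gamma> * B^3) * cnoidal_amplitude L k"
  define \<theta> where "\<theta> = (\<lambda>x. jacobi_am (b * x) k)"
  define \<Delta> where "\<Delta> = (\<lambda>x. sqrt (1 - k\<^sup>2 * (sin (\<theta> x))\<^sup>2))"
  define N where "N = (\<lambda>x. sqrt (1 - q * (sin (\<theta> x))\<^sup>2))"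
  define \<phi>' where "\<phi>' = (\<lambda>x. A * b * (q - 1) * (sin (\<theta> x) * \<Delta> x / (N x)^3))"
  have b: "b > 0" using ellipticK_pos[OF k] L by (simp add: b_def)
  have q: "q < 0" unfolding q_def by (rule cnoidal_q_neg[OF k])
  have k2: "k\<^sup>2 < 1" using k by (simp add: power_less_one_iff)
  have rad: "k^4 - k\<^sup>2 + 1 = (k\<^sup>2 - 1/2)\<^sup>2 + 3/4"
    by (simp add: power2_eq_square power4_eq_xxxx algebra_simps)
  have "0 < k^4 - k\<^sup>2 + 1" unfolding rad by (simp add: add_nonneg_pos)
  then have r: "r > 0" and r2: "r\<^sup>2 = (k\<^sup>2)\<^sup>2 - k\<^sup>2 + 1" by (simp_all add: r_def power_mult[symmetric])
  have q_eq: "q = -1 + k\<^sup>2 - r" by (simp add: q_def r_def cnoidal_q_def)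
  have X: "0 < (2 - k\<^sup>2 + 2 * r) * L\<^sup>2 * (ellipticK k)\<^sup>2"
    using k2 r L ellipticK_pos[OF k] by (intro mult_pos_pos) (auto intro: add_pos_pos)
  have A: "A > 0" using X c L by (simp add: A_def cnoidal_amplitude_def r_def)
  have A4: "(\<kappa> + \<gamma> * B^3) * A^4 = b\<^sup>2 * (2 - k\<^sup>2 + 2 * r)"
  proof -
    have "A^4 = (2 / L)^4 * ((2 - k\<^sup>2 + 2 * r) * L\<^sup>2 * (ellipticK k)\<^sup>2) / (\<kappa> + \<gamma> * B^3)"
      using X c unfolding A_def cnoidal_amplitude_def r_def
      by (simp add: power_mult_distrib power_divide real_root_pow_pos2)
    then have "(\<kappa> + \<gamma> * B^3) * A^4 = (2 / L)^4 * ((2 - k\<^sup>2 + 2 * r) * L\<^sup>2 * (ellipticK k)\<^sup>2)"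
      using c by simp
    also have "\<dots> = b\<^sup>2 * (2 - k\<^sup>2 + 2 * r)"
      using L by (simp add: b_def field_simps power2_eq_square power4_eq_xxxx)
    finally show ?thesis .
  qed
  have \<omega>: "cnoidal_frequency L k = b\<^sup>2 * r"
    by (simp add: cnoidal_frequency_def b_def r_def power_divide power_mult_distrib)
  have \<phi>_eq: "\<phi> x = A * (cos (\<theta> x) / N x)" for x
    by (simp add: \<phi>_def cnoidal_profile_def A_def \<theta>_def N_def b_def q_def jacobi_cn_def jacobi_sn_def)
  have \<Delta>pos: "\<Delta> x > 0" for x using elliptic_radicand_pos[OF k] by (simp add: \<Delta>_def)
  have Nrad: "1 - q * (sin (\<theta> x))\<^sup>2 > 0" for x
    using q mult_nonpos_nonneg[OF less_imp_le[OF q] zero_le_power2[of "sin (\<theta> x)"]] by linarith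
  have Npos: "N x > 0" for x using Nrad by (simp add: N_def)
  have N2: "(N x)\<^sup>2 = 1 - q * (sin (\<theta> x))\<^sup>2" for x using Nrad[of x] by (simp add: N_def)
  have \<Delta>2: "(\<Delta> x)\<^sup>2 = 1 - k\<^sup>2 * (sin (\<theta> x))\<^sup>2" for x
    using elliptic_radicand_pos[OF k, of "\<theta> x"] by (simp add: \<Delta>_def)
  have d\<theta>: "(\<theta> has_real_derivative b * \<Delta> x) (at x)" for x
  proof -
    have "((\<lambda>x. jacobi_am (b * x) k) has_real_derivative sqrt (1 - k\<^sup>2 * (sin (jacobi_am (b * x) k))\<^sup>2) * b) (at x)"
      by (rule DERIV_chain2[OF jacobi_am_has_derivative[OF k]]) (auto intro!: derivative_eq_intros)
    then show ?thesis by (simp add: \<theta>_def \<Delta>_def mult.commute)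
  qed
  have ds: "((\<lambda>x. sin (\<theta> x)) has_real_derivative cos (\<theta> x) * (b * \<Delta> x)) (at x)"
   and dc: "((\<lambda>x. cos (\<theta> x)) has_real_derivative - sin (\<theta> x) * (b * \<Delta> x)) (at x)" for x
    using DERIV_chain2[OF DERIV_sin d\<theta>] DERIV_chain2[OF DERIV_cos d\<theta>] by auto
  have d_sqrt: "((\<lambda>x. sqrt (1 - p * (sin (\<theta> x))\<^sup>2)) has_real_derivative
       - p * sin (\<theta> x) * cos (\<theta> x) * (b * \<Delta> x) / sqrt (1 - p * (sin (\<theta> x))\<^sup>2)) (at x)"
    if "1 - p * (sin (\<theta> x))\<^sup>2 > 0" for p x
  proof -
    have "((\<lambda>x. 1 - p * (sin (\<theta> x))\<^sup>2) has_real_derivative - (p * (2 * (sin (\<theta> x) * (cos (\<theta> x) * (b * \<Delta> x)))))) (at x)"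
      by (rule derivative_eq_intros ds refl)+ simp
    from DERIV_chain2[OF DERIV_real_sqrt[OF that] this]
    show ?thesis by (rule DERIV_cong) (simp add: field_simps)
  qed
  have d\<Delta>: "(\<Delta> has_real_derivative - k\<^sup>2 * sin (\<theta> x) * cos (\<theta> x) * b) (at x)" for x
  proof -
    have "sqrt (1 - k\<^sup>2 * (sin (\<theta> x))\<^sup>2) = \<Delta> x" by (simp add: \<Delta>_def)
    from d_sqrt[OF elliptic_radicand_pos[OF k], of x, unfolded this] show ?thesis
      using \<Delta>pos[of x] unfolding \<Delta>_def[symmetric] by (simp add: mult.assoc)
  qed
  have dN: "(N has_real_derivative - q * sin (\<theta> x) * cos (\<theta> x) * (b * \<Delta> x) / N x) (at x)" for x
  proof -
    have "sqrt (1 - q * (sin (\<theta> x))\<^sup>2) = N x" by (simp add: N_def)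
    from d_sqrt[OF Nrad, of x, unfolded this] show ?thesis unfolding N_def[symmetric] by simp
  qed
  show ?thesis
  proof
    fix x
    let ?s = "sin (\<theta> x)" and ?c = "cos (\<theta> x)"
    have c2: "?c\<^sup>2 = 1 - ?s\<^sup>2" by (rule cos_squared_eq)
    have "((\<lambda>x. A * (cos (\<theta> x) / N x)) has_real_derivative
       A * ((- ?s * (b * \<Delta> x) * N x - ?c * (- q * ?s * ?c * (b * \<Delta> x) / N x)) / (N x * N x))) (at x)"
      using Npos[of x] by (intro DERIV_cmult DERIV_divide dc dN) simp
    moreover have "A * ((- ?s * (b * \<Delta> x) * N x - ?c * (- q * ?s * ?c * (b * \<Delta> x) / N x)) / (N x * N x)) = \<phi>' x"
    proof -
      have "A * ((- ?s * (b * \<Delta> x) * N x - ?c * (- q * ?s * ?c * (b * \<Delta> x) / N x)) / (N x * N x))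
        = A * b * \<Delta> x * ?s * (q * ?c\<^sup>2 - (N x)\<^sup>2) / (N x)^3"
        using Npos[of x] by (simp add: field_simps power2_eq_square power3_eq_cube)
      also have "q * ?c\<^sup>2 - (N x)\<^sup>2 = q - 1" by (simp add: c2 N2 algebra_simps)
      finally show ?thesis by (simp add: \<phi>'_def mult_ac)
    qed
    ultimately show "(\<phi> has_real_derivative \<phi>' x) (at x)" by (simp add: \<phi>_eq[abs_def] \<phi>'_def)
    have dN3: "((\<lambda>x. (N x)^3) has_real_derivative
        3 * ((- q * ?s * ?c * (b * \<Delta> x) / N x) * (N x)^2)) (at x)"
      by (rule DERIV_cong[OF DERIV_power[OF dN[of x], of 3]]) simp
    have "((\<lambda>x. A * b * (q - 1) * (sin (\<theta> x) * \<Delta> x / (N x)^3)) has_real_derivative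
       A * b * (q - 1) * (((?c * (b * \<Delta> x) * \<Delta> x + (- k\<^sup>2 * ?s * ?c * b) * ?s) * (N x)^3
         - ?s * \<Delta> x * (3 * ((- q * ?s * ?c * (b * \<Delta> x) / N x) * (N x)^2))) / ((N x)^3 * (N x)^3))) (at x)"
      using Npos[of x] by (intro DERIV_cmult DERIV_divide DERIV_cong[OF DERIV_mult[OF ds d\<Delta>]] dN3) auto
    moreover have "A * b * (q - 1) * (((?c * (b * \<Delta> x) * \<Delta> x + (- k\<^sup>2 * ?s * ?c * b) * ?s) * (N x)^3
         - ?s * \<Delta> x * (3 * ((- q * ?s * ?c * (b * \<Delta> x) / N x) * (N x)^2))) / ((N x)^3 * (N x)^3))
       = (cnoidal_frequency L k - (\<kappa> + \<gamma> * B^3) * (\<phi> x)^4) * \<phi> x"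
      (is "?lhs = ?rhs")
    proof -
      have "?lhs = A * b\<^sup>2 * ?c * ((q - 1) * ((\<Delta> x)\<^sup>2 * (N x)\<^sup>2 - k\<^sup>2 * ?s\<^sup>2 * (N x)\<^sup>2 + 3 * q * ?s\<^sup>2 * (\<Delta> x)\<^sup>2)) / (N x)^5"
        using Npos[of x] by (simp add: field_simps eval_nat_numeral)
      also have "(q - 1) * ((\<Delta> x)\<^sup>2 * (N x)\<^sup>2 - k\<^sup>2 * ?s\<^sup>2 * (N x)\<^sup>2 + 3 * q * ?s\<^sup>2 * (\<Delta> x)\<^sup>2)
         = r * ((N x)\<^sup>2)\<^sup>2 - (2 - k\<^sup>2 + 2 * r) * (?c\<^sup>2)\<^sup>2"
        using cnoidal_polynomial_identity[OF r2 q_eq, of "?s\<^sup>2"] by (simp add: N2 \<Delta>2 c2)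
      also have "A * b\<^sup>2 * ?c * (r * ((N x)\<^sup>2)\<^sup>2 - (2 - k\<^sup>2 + 2 * r) * (?c\<^sup>2)\<^sup>2) / (N x)^5
         = (b\<^sup>2 * r - (b\<^sup>2 * (2 - k\<^sup>2 + 2 * r)) * (?c / N x)^4) * (A * (?c / N x))"
        using Npos[of x] by (simp add: field_simps eval_nat_numeral)
      also have "\<dots> = ?rhs"
        by (simp add: \<omega> \<phi>_eq A4[symmetric] power_mult_distrib power_divide)
      finally show ?thesis .
    qed
    ultimately show "(\<phi>' has_real_derivative (cnoidal_frequency L k - (\<kappa> + \<gamma> * B^3) * (\<phi> x)^4) * \<phi> x) (at x)"
      by (simp add: \<phi>'_def[abs_def])
  next
    have "\<theta> 0 = 0" by (simp add: \<theta>_def jacobi_am_simps k)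
    then show "\<phi> 0 > 0" "\<phi>' 0 = 0" using A Npos[of 0] by (simp_all add: \<phi>_eq \<phi>'_def)
    have "\<theta> (L / 4) = pi / 2" using L by (simp add: \<theta>_def b_def jacobi_am_simps k)
    then have pos: "0 < sin (\<theta> (L / 4)) * \<Delta> (L / 4) / (N (L / 4))^3"
      by (simp only: sin_pi_half) (simp add: \<Delta>pos Npos)
    have "A * b * (q - 1) < 0"
      using A b q by (intro mult_pos_neg mult_pos_pos) auto
    from this pos show "\<phi>' (L / 4) < 0" unfolding \<phi>'_def by (rule mult_neg_pos)
  qed
qed

section \<open>Fourier coefficients of smooth periodic functions\<close>

lemma continuous_on_cis_linear: "continuous_on S (\<lambda>x. cis (a * x / L))"
  "continuous_on S (\<lambda>x. cis (- (a * x / L)))"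
  unfolding divide_inverse by (intro continuous_intros)+

lemma fourier_coeff_eq_integral:
  assumes "continuous_on UNIV f"
  shows "fourier_coeff L f n =
    complex_of_real (1 / L) * integral {0..L} (\<lambda>x. f x * cis (- (2 * pi * real_of_int n * x / L)))"
proof -
  have "continuous_on {0..L} (\<lambda>x. f x * cis (- (2 * pi * real_of_int n * x / L)))"
    by (intro continuous_on_mult continuous_on_cis_linear continuous_on_subset[OF assms]) auto
  then show ?thesis
    unfolding fourier_coeff_def
    by (subst set_borel_integral_eq_integral(2)[OF borel_integrable_atLeastAtMost']) auto
qed

lemma fourier_integrand_integrable:
  assumes "continuous_on UNIV f"
  shows "(\<lambda>x. f x * cis (- (2 * pi * real_of_int n * x / L))) integrable_on {0..L}"
  by (intro integrable_continuous_real continuous_on_mult continuous_on_cis_linear continuous_on_subset[OF assms]) auto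

lemma fourier_coeff_diff_cmult:
  assumes f: "continuous_on UNIV f" and g: "continuous_on UNIV g"
  shows "fourier_coeff L (\<lambda>x. f x - c * g x) n = fourier_coeff L f n - c * fourier_coeff L g n"
proof -
  let ?e = "\<lambda>x. cis (- (2 * pi * real_of_int n * x / L))"
  have "integral {0..L} (\<lambda>x. (f x - c * g x) * ?e x) = integral {0..L} (\<lambda>x. f x * ?e x - c * (g x * ?e x))"
    by (simp add: algebra_simps)
  also have "\<dots> = integral {0..L} (\<lambda>x. f x * ?e x) - c * integral {0..L} (\<lambda>x. g x * ?e x)"
    by (subst integral_diff) (auto intro!: fourier_integrand_integrable integrable_on_mult_right f g)
  finally show ?thesis
    by (simp add: fourier_coeff_eq_integral f g continuous_on_diff continuous_on_mult right_diff_distrib)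
qed

lemma fourier_coeff_deriv:
  assumes L: "L > 0" and f: "\<And>x. (f has_vector_derivative f' x) (at x)"
    and f': "continuous_on UNIV f'" and per: "\<And>x. f (x + L) = f x"
  shows "fourier_coeff L f' n = \<i> * complex_of_real (2 * pi * real_of_int n / L) * fourier_coeff L f n"
proof -
  define a where "a = 2 * pi * real_of_int n / L"
  let ?e = "\<lambda>x. cis (- (a * x))"
  have cf: "continuous_on UNIV f"
    using f by (auto intro: continuous_at_imp_continuous_on has_vector_derivative_continuous)
  have de: "(?e has_vector_derivative - \<i> * complex_of_real a * ?e x) (at x)" for x
  proof -
    have "((\<lambda>z. exp (- \<i> * complex_of_real a * z)) has_field_derivative
        - \<i> * complex_of_real a * exp (- \<i> * complex_of_real a * complex_of_real x)) (at (complex_of_real x))"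
      by (auto intro!: derivative_eq_intros)
    from has_vector_derivative_real_field[OF this] show ?thesis
      by (simp add: cis_conv_exp mult.assoc)
  qed
  have I1: "((\<lambda>x. f x * (- \<i> * complex_of_real a * ?e x) + f' x * ?e x) has_integral (f L * ?e L - f 0 * ?e 0)) {0..L}"
    by (rule fundamental_theorem_of_calculus)
      (use L has_vector_derivative_mult[OF f de] in \<open>auto intro: has_vector_derivative_at_within\<close>)
  have end_vals: "f L * ?e L - f 0 * ?e 0 = 0"
  proof -
    have "?e L = 1"
      using L cis_multiple_2pi[of "- real_of_int n"] by (simp add: a_def)
    then show ?thesis using per[of 0] by simp
  qed
  have I2: "((\<lambda>x. f x * (- \<i> * complex_of_real a * ?e x) + f' x * ?e x) has_integral
     (- \<i> * complex_of_real a * integral {0..L} (\<lambda>x. f x * ?e x) + integral {0..L} (\<lambda>x. f' x * ?e x))) {0..L}"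
  proof -
    have "((\<lambda>x. (- \<i> * complex_of_real a) * (f x * ?e x) + f' x * ?e x) has_integral
     ((- \<i> * complex_of_real a) * integral {0..L} (\<lambda>x. f x * ?e x) + integral {0..L} (\<lambda>x. f' x * ?e x))) {0..L}"
      using fourier_integrand_integrable[OF cf, of n L] fourier_integrand_integrable[OF f', of n L]
      by (intro has_integral_add has_integral_mult_right integrable_integral) (simp_all add: a_def)
    then show ?thesis by (simp add: mult_ac)
  qed
  have "- \<i> * complex_of_real a * integral {0..L} (\<lambda>x. f x * ?e x) + integral {0..L} (\<lambda>x. f' x * ?e x) = 0"
    using has_integral_unique[OF I2 I1] end_vals by (rule trans)
  then have "integral {0..L} (\<lambda>x. f' x * ?e x) = \<i> * complex_of_real a * integral {0..L} (\<lambda>x. f x * ?e x)"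
    by (simp add: add_eq_0_iff)
  then show ?thesis
    by (simp add: fourier_coeff_eq_integral cf f' a_def)
qed

lemma fourier_coeff_const:
  assumes "L > 0" "n \<noteq> 0"
  shows "fourier_coeff L (\<lambda>x. c) n = 0"
proof -
  have "fourier_coeff L (\<lambda>x. 0) n = \<i> * complex_of_real (2 * pi * real_of_int n / L) * fourier_coeff L (\<lambda>x. c) n"
    by (rule fourier_coeff_deriv) (use assms in auto)
  moreover have "fourier_coeff L (\<lambda>x. 0) n = 0"
    by (simp add: fourier_coeff_eq_integral)
  ultimately show ?thesis using assms by simp
qed

text \<open>Multiplying by a character shifts the index, so orthogonality of the characters is a statement
  about the constant function \<open>1\<close>.\<close>

lemma fourier_coeff_cis:
  assumes "L > 0" "n \<noteq> m"
  shows "fourier_coeff L (\<lambda>x. cis (2 * pi * real_of_int m * x / L)) n = 0"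
proof -
  have "fourier_coeff L (\<lambda>x. cis (2 * pi * real_of_int m * x / L)) n = fourier_coeff L (\<lambda>x. 1) (n - m)"
    by (simp add: fourier_coeff_def cis_mult algebra_simps diff_divide_distrib)
  then show ?thesis using fourier_coeff_const[of L "n - m" 1] assms by simp
qed

lemma integral_norm_diff_fourier_mode:
  assumes L: "L > 0" and h: "continuous_on UNIV h" and c: "c = fourier_coeff L h m"
  shows "integral {0..L} (\<lambda>x. (cmod (h x - c * cis (2 * pi * real_of_int m * x / L)))\<^sup>2)
    = integral {0..L} (\<lambda>x. (cmod (h x))\<^sup>2) - L * (cmod c)\<^sup>2"
proof -
  let ?e = "\<lambda>x. cis (- (2 * pi * real_of_int m * x / L))"
  have pw: "(cmod (h x - c * cis (2 * pi * real_of_int m * x / L)))\<^sup>2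
     = (cmod (h x))\<^sup>2 - Re (2 * cnj c * (h x * ?e x)) + (cmod c)\<^sup>2" for x
  proof -
    have gen: "(cmod (z - c * u))\<^sup>2 = (cmod z)\<^sup>2 - Re (2 * cnj c * (z * cnj u)) + (cmod c)\<^sup>2 * (cmod u)\<^sup>2" for z u
      by (simp only: cmod_power2) (simp add: power2_eq_square algebra_simps)
    show ?thesis
      using gen[of "h x" "cis (2 * pi * real_of_int m * x / L)"] by (simp add: cis_cnj)
  qed
  have "((\<lambda>x. h x * ?e x) has_integral (complex_of_real L * c)) {0..L}"
    using integrable_integral[OF fourier_integrand_integrable[OF h, of m L]] L
    by (simp add: c fourier_coeff_eq_integral[OF h])
  then have "((\<lambda>x. Re (2 * cnj c * (h x * ?e x))) has_integral Re (2 * cnj c * (complex_of_real L * c))) {0..L}"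
    by (intro has_integral_Re has_integral_mult_right)
  moreover have "((\<lambda>x. (cmod (h x))\<^sup>2) has_integral integral {0..L} (\<lambda>x. (cmod (h x))\<^sup>2)) {0..L}"
    by (intro integrable_integral integrable_continuous_real continuous_intros continuous_on_subset[OF h]) auto
  moreover have "((\<lambda>x. (cmod c)\<^sup>2) has_integral (L * (cmod c)\<^sup>2)) {0..L}"
    using has_integral_const_real[of "(cmod c)\<^sup>2" 0 L] L by simp
  ultimately have "((\<lambda>x. (cmod (h x))\<^sup>2 - Re (2 * cnj c * (h x * ?e x)) + (cmod c)\<^sup>2) has_integral
    (integral {0..L} (\<lambda>x. (cmod (h x))\<^sup>2) - Re (2 * cnj c * (complex_of_real L * c)) + L * (cmod c)\<^sup>2)) {0..L}"
    by (intro has_integral_add has_integral_diff)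
  moreover have "Re (2 * cnj c * (complex_of_real L * c)) = 2 * (L * (cmod c)\<^sup>2)"
    by (simp only: cmod_power2) (simp add: power2_eq_square algebra_simps)
  ultimately show ?thesis unfolding pw by (simp add: integral_unique)
qed

text \<open>The modes in \<open>F\<close> are projected away one at a time. Each step leaves the other coefficients unchanged
  and lowers the squared norm by \<open>L \<bar>c\<bar>\<^sup>2\<close>, and what is left is nonnegative.\<close>

lemma bessel_inequality:
  assumes L: "L > 0" and g: "continuous_on UNIV g" and "finite F"
  shows "L * (\<Sum>n\<in>F. (cmod (fourier_coeff L g n))\<^sup>2) \<le> integral {0..L} (\<lambda>x. (cmod (g x))\<^sup>2)"
proof -
  have "\<exists>h. continuous_on UNIV h \<and> (\<forall>m. m \<notin> F \<longrightarrow> fourier_coeff L h m = fourier_coeff L g m) \<and>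
    integral {0..L} (\<lambda>x. (cmod (h x))\<^sup>2) =
      integral {0..L} (\<lambda>x. (cmod (g x))\<^sup>2) - L * (\<Sum>n\<in>F. (cmod (fourier_coeff L g n))\<^sup>2)"
    using \<open>finite F\<close>
  proof (induction F rule: finite_induct)
    case empty
    then show ?case using g by auto
  next
    case (insert m F)
    then obtain h where h: "continuous_on UNIV h" "\<And>m. m \<notin> F \<Longrightarrow> fourier_coeff L h m = fourier_coeff L g m"
      "integral {0..L} (\<lambda>x. (cmod (h x))\<^sup>2) =
        integral {0..L} (\<lambda>x. (cmod (g x))\<^sup>2) - L * (\<Sum>n\<in>F. (cmod (fourier_coeff L g n))\<^sup>2)" by blast
    let ?c = "fourier_coeff L g m" and ?u = "\<lambda>x. cis (2 * pi * real_of_int m * x / L)"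
    have u: "continuous_on UNIV ?u" by (rule continuous_on_cis_linear)
    show ?case
    proof (intro exI[of _ "\<lambda>x. h x - ?c * ?u x"] conjI allI impI)
      show "continuous_on UNIV (\<lambda>x. h x - ?c * ?u x)"
        by (intro continuous_on_diff continuous_on_mult continuous_on_const h u)
      show "fourier_coeff L (\<lambda>x. h x - ?c * ?u x) n = fourier_coeff L g n" if "n \<notin> insert m F" for n
        using that h(2)[of n] fourier_coeff_cis[OF L, of n m] by (simp add: fourier_coeff_diff_cmult h(1) u)
      show "integral {0..L} (\<lambda>x. (cmod (h x - ?c * ?u x))\<^sup>2) = integral {0..L} (\<lambda>x. (cmod (g x))\<^sup>2)
          - L * (\<Sum>n\<in>insert m F. (cmod (fourier_coeff L g n))\<^sup>2)"
        using integral_norm_diff_fourier_mode[OF L h(1), of ?c m] h(2)[of m] h(3) insert.hyps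
        by (simp add: algebra_simps)
    qed
  qed
  then obtain h where h: "continuous_on UNIV h" "integral {0..L} (\<lambda>x. (cmod (h x))\<^sup>2) =
      integral {0..L} (\<lambda>x. (cmod (g x))\<^sup>2) - L * (\<Sum>n\<in>F. (cmod (fourier_coeff L g n))\<^sup>2)" by blast
  have "0 \<le> integral {0..L} (\<lambda>x. (cmod (h x))\<^sup>2)"
    by (intro integral_nonneg integrable_continuous_real continuous_intros continuous_on_subset[OF h(1)]) auto
  then show ?thesis using h(2) by linarith
qed

lemma continuous_periodic_in_L2_per:
  assumes "continuous_on UNIV f" "\<And>x. f (x + L) = f x"
  shows "f \<in> L2_per L"
proof -
  have "set_integrable lborel {0..L} (\<lambda>x. (cmod (f x))\<^sup>2)"
    by (intro borel_integrable_atLeastAtMost' continuous_intros continuous_on_subset[OF assms(1)]) auto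
  then show ?thesis using assms borel_measurable_continuous_onI by (auto simp: L2_per_def)
qed

lemma C2_periodic_has_per_deriv:
  assumes L: "L > 0" and f: "\<And>x. (f has_vector_derivative f' x) (at x)"
    and f': "\<And>x. (f' has_vector_derivative f'' x) (at x)"
    and f'': "continuous_on UNIV f''" and per: "\<And>x. f (x + L) = f x"
  shows "has_per_deriv L 2 f f''" "f \<in> H_per L 2"
proof -
  have cont: "continuous_on UNIV f" "continuous_on UNIV f'"
    using f f' by (auto intro!: continuous_at_imp_continuous_on has_vector_derivative_continuous)
  have per_deriv: "d' (x + L) = d' x"
    if d: "\<And>x. (d has_vector_derivative d' x) (at x)" "\<And>x. d (x + L) = d x"
    for d d' :: "real \<Rightarrow> complex" and x
  proof -
    have "((\<lambda>x. x + L) has_vector_derivative 1) (at x)" by (auto intro!: derivative_eq_intros)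
    from vector_diff_chain_at[OF this d(1)] have "(d has_vector_derivative d' (x + L)) (at x)"
      by (simp add: o_def d(2))
    then show ?thesis using d(1) vector_derivative_unique_at by blast
  qed
  have per': "f' (x + L) = f' x" for x using per_deriv[OF f per] .
  have per'': "f'' (x + L) = f'' x" for x using per_deriv[OF f' per'] .
  have coeff: "fourier_coeff L f'' n =
      (\<i> * complex_of_real (2 * pi * real_of_int n / L)) ^ 2 * fourier_coeff L f n" for n
    using fourier_coeff_deriv[OF L f' f'' per'] fourier_coeff_deriv[OF L f cont(2) per]
    by (simp add: power2_eq_square)
  have L2: "f \<in> L2_per L" "f'' \<in> L2_per L"
    using continuous_periodic_in_L2_per cont f'' per per'' by blast+
  show "has_per_deriv L 2 f f''"
    unfolding has_per_deriv_def using L2 coeff by blast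
  \<comment> \<open>The multiplier of \<open>1 - (L / (2 pi))\<^sup>2 \<partial>\<^sup>2\<close> is \<open>1 + n\<^sup>2\<close>, the weight of the Sobolev norm.\<close>
  define g where "g = (\<lambda>x. f x - complex_of_real ((L / (2 * pi))\<^sup>2) * f'' x)"
  have g: "continuous_on UNIV g"
    unfolding g_def by (intro continuous_on_diff continuous_on_mult continuous_on_const cont f'')
  have weight: "(1 + (real_of_int n)\<^sup>2) powr 2 * (cmod (fourier_coeff L f n))\<^sup>2 = (cmod (fourier_coeff L g n))\<^sup>2" for n
  proof -
    have "fourier_coeff L g n = complex_of_real (1 + (real_of_int n)\<^sup>2) * fourier_coeff L f n"
      using L unfolding g_def fourier_coeff_diff_cmult[OF cont(1) f''] coeff
      by (simp add: power_mult_distrib power_divide field_simps)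
    moreover have "1 + (real_of_int n)\<^sup>2 > 0" by (simp add: add_pos_nonneg)
    ultimately show ?thesis by (simp add: norm_mult power_mult_distrib powr_numeral del: of_real_add)
  qed
  have "(\<lambda>n. (cmod (fourier_coeff L g n))\<^sup>2) summable_on UNIV"
  proof (rule nonneg_bdd_above_summable_on)
    show "bdd_above (sum (\<lambda>n. (cmod (fourier_coeff L g n))\<^sup>2) ` {F. F \<subseteq> UNIV \<and> finite F})"
    proof (rule bdd_aboveI)
      fix y assume "y \<in> sum (\<lambda>n. (cmod (fourier_coeff L g n))\<^sup>2) ` {F. F \<subseteq> UNIV \<and> finite F}"
      then show "y \<le> integral {0..L} (\<lambda>x. (cmod (g x))\<^sup>2) / L"
        using bessel_inequality[OF L g] L by (auto simp: pos_le_divide_eq mult.commute)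
    qed
  qed simp
  then show "f \<in> H_per L 2"
    unfolding H_per_def mem_Collect_eq weight using L2 by simp
qed

section \<open>The antisymmetric eigenfunction\<close>

lemma vector_4:
  "(vector [a, b, c, d] :: ('a::zero)^4) $ 1 = a"
  "(vector [a, b, c, d] :: ('a::zero)^4) $ 2 = b"
  "(vector [a, b, c, d] :: ('a::zero)^4) $ 3 = c"
  "(vector [a, b, c, d] :: ('a::zero)^4) $ 4 = d"
  unfolding vector_def by simp_all

lemma continuous_AE_zero_imp_zero:
  fixes f :: "real \<Rightarrow> 'a::real_normed_vector"
  assumes f: "continuous_on UNIV f" and ae: "AE x in lborel. f x = 0"
  shows "f a = 0"
proof (rule ccontr)
  assume "f a \<noteq> 0"
  moreover have "isCont f a" using f by (simp add: continuous_on_eq_continuous_at)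
  ultimately obtain d where d: "d > 0" "\<And>y. dist a y < d \<Longrightarrow> f y \<noteq> 0"
    using continuous_at_avoid[of a f 0] by blast
  from ae obtain N where N: "\<And>x. x \<in> space lborel - N \<Longrightarrow> f x = 0" "N \<in> null_sets lborel"
    by (rule AE_E3) (rule that)
  have "{a..a + d / 2} \<subseteq> N"
  proof
    fix x assume "x \<in> {a..a + d / 2}"
    then have "dist a x < d" using d(1) by (auto simp: dist_real_def)
    with d(2)[of x] N(1)[of x] show "x \<in> N" by auto
  qed
  then have "emeasure lborel {a..a + d / 2} \<le> 0"
    using emeasure_mono[of "{a..a + d / 2}" N lborel] N(2) by (auto simp: null_sets_def)
  then show False using d(1) by simp
qed

text \<open>Perturbations antisymmetric in the two components, with \<open>z = u + \<i> v\<close>. On them \<open>J\<close> acts as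
  multiplication by \<open>- \<i>\<close>.\<close>

definition antisym_state :: "complex \<Rightarrow> complex^4" where
  "antisym_state z = vector [complex_of_real (Re z), - complex_of_real (Re z),
     complex_of_real (Im z), - complex_of_real (Im z)]"

lemma antisym_state_nth:
  "antisym_state z $ 1 = complex_of_real (Re z)" "antisym_state z $ 2 = - complex_of_real (Re z)"
  "antisym_state z $ 3 = complex_of_real (Im z)" "antisym_state z $ 4 = - complex_of_real (Im z)"
  by (simp_all add: antisym_state_def vector_4)

lemma bounded_linear_antisym_state_nth: "bounded_linear (\<lambda>z. antisym_state z $ i)"
proof -
  have "\<forall>i. bounded_linear (\<lambda>z. antisym_state z $ i)"
    unfolding forall_4 antisym_state_nth
    by (intro conjI bounded_linear_minus bounded_linear_compose[OF bounded_linear_of_real]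
        bounded_linear_Re bounded_linear_Im)
  then show ?thesis ..
qed

text \<open>On antisymmetric vectors \<open>S\<close> has the eigenvalues \<open>9 \<kappa> - 6 \<kappa> = 3 \<kappa>\<close> and \<open>- 3 \<kappa> - 6 \<kappa> = - 9 \<kappa>\<close>, which is where the
  opposite signs of the potentials \<open>- V\<close> and \<open>3 V\<close> come from.\<close>

lemma matS_antisym_state:
  "cmat (matS \<kappa> (2 * \<kappa>) 1) *v antisym_state z = complex_of_real (3 * \<kappa>) *s antisym_state (2 * cnj z - z)"
  by (simp add: vec_eq_iff forall_4 matrix_vector_mult_def sum_4 cmat_def map_matrix_def matS_def
      vector_4 antisym_state_nth algebra_simps)

lemma matJ_antisym_state: "cmat matJ *v antisym_state z = antisym_state (- \<i> * z)"
  by (simp add: vec_eq_iff forall_4 matrix_vector_mult_def sum_4 cmat_def map_matrix_def matJ_def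
      vector_4 antisym_state_nth)

lemma eigenvalue_of_mode:
  assumes L: "L > 0" and \<kappa>: "\<kappa> \<ge> 0" and \<phi>: "continuous_on UNIV \<phi>"
    and w: "mode_eq \<omega> (\<lambda>x. 3 * \<kappa> * (\<phi> x)^4) \<mu> 1 w w'"
    and per: "\<And>x. w (x + L) = w x" and nz: "w 0 \<noteq> 0"
  shows "is_eigenvalue (J_linearized_op L \<kappa> (2 * \<kappa>) 1 \<omega> \<phi>) (complex_of_real \<mu>)"
proof -
  define w'' where "w'' = (\<lambda>x. \<omega> *\<^sub>R w x - \<mu> *\<^sub>R (\<i> * w x) + (3 * \<kappa> * (\<phi> x)^4) *\<^sub>R (w x - 2 * cnj (w x)))"
  have d: "(w has_vector_derivative w' x) (at x)" "(w' has_vector_derivative w'' x) (at x)" for x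
    using mode_eqD[OF w, of x] by (simp_all add: w''_def)
  have cw: "continuous_on UNIV w"
    using d(1) by (auto intro!: continuous_at_imp_continuous_on has_vector_derivative_continuous)
  have cw'': "continuous_on UNIV w''"
    unfolding w''_def by (intro continuous_intros cw \<phi>)
  note lin = bounded_linear_antisym_state_nth
  have comp: "has_per_deriv L 2 (\<lambda>x. antisym_state (w x) $ i) (\<lambda>x. antisym_state (w'' x) $ i)"
      "(\<lambda>x. antisym_state (w x) $ i) \<in> H_per L 2" for i
    using C2_periodic_has_per_deriv[OF L, of "\<lambda>x. antisym_state (w x) $ i" "\<lambda>x. antisym_state (w' x) $ i" "\<lambda>x. antisym_state (w'' x) $ i"]
      bounded_linear.has_vector_derivative[OF lin d(1)] bounded_linear.has_vector_derivative[OF lin d(2)]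
      bounded_linear.continuous_on[OF lin cw''] per by simp_all
  \<comment> \<open>Since \<open>J\<close> is \<open>- \<i>\<close> here, the eigenvalue equation \<open>J Z = \<mu> w\<close> dictates \<open>Z = \<mu> \<i> w\<close>.\<close>
  define Z where "Z = (\<lambda>x. antisym_state (\<mu> *\<^sub>R (\<i> * w x)))"
  have Z: "Z \<in> L2_per4 L"
    unfolding L2_per4_def Z_def mem_Collect_eq
    by (intro allI continuous_periodic_in_L2_per bounded_linear.continuous_on[OF lin] continuous_intros cw)
      (simp add: per)
  have eq: "Z x = - antisym_state (w'' x) + complex_of_real \<omega> *s antisym_state (w x)
      - complex_of_real ((\<phi> x)^4) *s (cmat (matS \<kappa> (2 * \<kappa>) 1) *v antisym_state (w x))" for x
    unfolding matS_antisym_state Z_def w''_def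
    by (simp add: vec_eq_iff forall_4 antisym_state_nth algebra_simps)
  have "((\<lambda>x. antisym_state (w x)), Z) \<in> linearized_op L \<kappa> (2 * \<kappa>) 1 \<omega> \<phi>"
    unfolding linearized_op_def H_per4_def mem_Collect_eq case_prod_conv
    using comp Z eq by (intro conjI exI[of _ "\<lambda>x. antisym_state (w'' x)"]) auto
  moreover have "(\<lambda>x. complex_of_real \<mu> *s antisym_state (w x)) = (\<lambda>x. cmat matJ *v Z x)"
    unfolding Z_def matJ_antisym_state by (simp add: fun_eq_iff vec_eq_iff forall_4 antisym_state_nth)
  ultimately have "((\<lambda>x. antisym_state (w x)), (\<lambda>x. complex_of_real \<mu> *s antisym_state (w x)))
      \<in> J_linearized_op L \<kappa> (2 * \<kappa>) 1 \<omega> \<phi>"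
    unfolding J_linearized_op_def by blast
  moreover have "\<not> (AE x in lborel. antisym_state (w x) = 0)"
  proof
    assume "AE x in lborel. antisym_state (w x) = 0"
    then have "AE x in lborel. w x = 0"
      by eventually_elim (auto simp: vec_eq_iff forall_4 antisym_state_nth complex_eq_iff)
    with continuous_AE_zero_imp_zero[OF cw] nz show False by blast
  qed
  ultimately show ?thesis
    unfolding is_eigenvalue_def by - (rule exI[of _ "\<lambda>x. antisym_state (w x)"], rule conjI)
qed

theorem theorem1p4:
  fixes L \<kappa> \<gamma> \<omega> B k :: real
  assumes "L > 0" and "\<kappa> > 0" and "\<gamma> \<ge> 0"
    and "\<omega> > 4 * pi\<^sup>2 / L\<^sup>2"
    and "0 < k" and "k < 1" and "\<omega> = cnoidal_frequency L k"
    and "B = 1" and "\<gamma> = 2 * \<kappa>"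
  shows "spectrally_unstable L \<kappa> \<gamma> B \<omega> (cnoidal_profile L \<kappa> \<gamma> B k)"
proof -
  define \<phi> where "\<phi> = cnoidal_profile L \<kappa> (2 * \<kappa>) 1 k"
  let ?V = "\<lambda>x. 3 * \<kappa> * (\<phi> x)^4"
  note k = \<open>0 < k\<close> \<open>k < 1\<close>
  have "\<kappa> + 2 * \<kappa> * 1^3 > 0" using \<open>\<kappa> > 0\<close> by simp
  then obtain \<phi>' where \<phi>': "\<And>x. (\<phi> has_real_derivative \<phi>' x) (at x)"
    "\<And>x. (\<phi>' has_real_derivative (\<omega> - (\<kappa> + 2 * \<kappa> * 1^3) * (\<phi> x)^4) * \<phi> x) (at x)"
    "\<phi> 0 > 0" "\<phi>' 0 = 0" "\<phi>' (L / 4) < 0"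
    using cnoidal_profile_ode[OF \<open>L > 0\<close> k] unfolding \<phi>_def \<open>\<omega> = _\<close> by blast
  have \<phi>: "continuous_on UNIV \<phi>"
    using \<phi>'(1) by (auto intro!: continuous_at_imp_continuous_on DERIV_isCont)
  have even: "\<phi> (- x) = \<phi> x" for x
    unfolding \<phi>_def by (rule cnoidal_profile_minus[OF k])
  have half: "\<phi> (2 * (L / 4) - x) = - \<phi> x" for x
    using cnoidal_profile_half_period[OF k \<open>L > 0\<close>, of \<kappa> "2 * \<kappa>" 1 "- x"] even[of x]
    by (simp add: \<phi>_def add.commute)
  have "0 < 4 * pi\<^sup>2 / L\<^sup>2" using \<open>L > 0\<close> by simp
  then have "\<omega> > 0" using \<open>\<omega> > 4 * pi\<^sup>2 / L\<^sup>2\<close> by linarith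
  obtain \<mu> w w' where \<mu>: "\<mu> > 0" and w: "mode_eq \<omega> ?V \<mu> 1 w w'" "w 0 \<noteq> 0"
    "\<And>x. w (x + 2 * (L / 4)) = w x"
  proof (rule unstable_mode_exists[of ?V "L / 4" \<omega> \<phi> \<phi>'])
    show "continuous_on UNIV ?V" by (intro continuous_intros \<phi>)
    show "(\<phi>' has_real_derivative (\<omega> - ?V x) * \<phi> x) (at x)" for x
      using \<phi>'(2)[of x] by simp
  qed (use \<open>\<kappa> > 0\<close> \<open>\<omega> > 0\<close> \<open>L > 0\<close> even half \<phi>' in auto)
  have "w (x + L) = w x" for x
    using w(3)[of x] w(3)[of "x + 2 * (L / 4)"] by (simp add: add.assoc)
  from eigenvalue_of_mode[OF \<open>L > 0\<close> _ \<phi> w(1) this w(2)] \<mu> \<open>\<kappa> > 0\<close>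
  show ?thesis
    unfolding spectrally_unstable_def \<open>B = 1\<close> \<open>\<gamma> = 2 * \<kappa>\<close> \<phi>_def[symmetric]
    by (intro exI[of _ "complex_of_real \<mu>"]) simp
qed

end
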